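(* For any point $x_0$ on the $x$-axis, with $a:=\overline{\mathrm D}_-\Phi(x_0)$ and $b:=\underline{\mathrm D}_+\Phi(x_0)$, the initial wave for the Cauchy problem $u_t+f(u)_x=0$, $u|_{t=0}=\varphi$, emitting from $x_0$ must be one of the following six cases: (i) If $a>b$, or $a=b$ with $\mathcal{C}(x_0)=\varnothing$, then the initial wave emitting from $x_0$ is a shock $\mathcal{S}$. (ii) If $a=b$ with $\mathcal{C}(x_0)\neq\varnothing$, then the initial wave emitting from $x_0$ is a characteristic. (iii) If $a<b$ and $\mathcal{C}(x_0)=[a,b]$, then the initial wave emitting from $x_0$ is a rarefaction wave $\mathcal{R}$. (iv) If $a<b$ and $\mathcal{C}(x_0)=(a,b]$, then the initial wave emitting from $x_0$ is $\mathcal{S}+\mathcal{R}$. (v) If $a<b$ and $\mathcal{C}(x_0)=[a,b)$, then the initial wave emitting from $x_0$ is $\mathcal{R}+\mathcal{S}$. (vi) If $a<b$ and $\mathcal{C}(x_0)=(a,b)$, then the initial wave emitting from $x_0$ is $\mathcal{S}+\mathcal{R}+\mathcal{S}$.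
   Context: Setting: $f\in C^2(\mathbb{R})$, $f''\ge0$, $\mathcal{L}\{f''=0\}=0$, so $f'$ is strictly increasing; $\varphi\in L^\infty(\mathbb{R})$. For $t>0$: $E(u;x,t)=t\int_0^u f''(s)(\varphi(x-tf'(s))-s)\,ds$, $\mathcal{U}(x,t)$ is the (nonempty compact) set of maximizers of $E(\cdot\,;x,t)$ over $\mathbb{R}$; the entropy solution is $u(x,t)=\inf\mathcal{U}(x,t)$, with traces $u(x-,t)=\sup\mathcal{U}(x,t)$, $u(x+,t)=\inf\mathcal{U}(x,t)$. $L_c(x_0)=\{(x,t): x=x_0+tf'(c),\ t>0\}$; $\mathcal{C}(x_0)=\{c\in\mathbb{R}: c\in\mathcal{U}(x,t)\text{ for some }(x,t)\in L_c(x_0)\}$; for $c\in\mathcal C(x_0)$, $L_c(x_0)$ is called a characteristic emitting from $x_0$. (If $c\in\mathcal U(x_1,t_1)$ with $(x_1,t_1)\in L_c(x_0)$, then $\mathcal{U}(x,t)=\{c\}$ along $L_c(x_0)$ for $0<t<t_1$.) $\Phi(x)=\int_0^x\varphi\,d\xi$, $\overline{\mathrm D}_-\Phi(x_0)=\limsup_{l\to0-}\frac1l\int_{x_0}^{x_0+l}\varphi\,d\xi$, $\underline{\mathrm D}_+\Phi(x_0)=\liminf_{l\to0+}\frac1l\int_{x_0}^{x_0+l}\varphi\,d\xi$. Terminology (all local in time near $t=0$). A shock emitting from $x_0$ is a continuous curve $x=x(t)$, $t\in[0,T)$ for some $T>0$, with $x(0)=x_0$ and $u(x(t)-,t)>u(x(t)+,t)$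 for $t\in(0,T)$. "The initial wave is a shock $\mathcal{S}$": a shock emits from $x_0$ and no characteristic emits from $x_0$. "The initial wave is a characteristic": exactly one characteristic and no shock emits from $x_0$. A rarefaction wave $\mathcal{R}$ emitting from $x_0$ is the fan of characteristics $\{L_c(x_0)\}_{c\in\mathcal{C}(x_0)}$ when $\mathcal C(x_0)$ is a nondegenerate interval. A shock $x(t)$ emitting from $x_0$ lies on the left (right) of $\mathcal R$ if for every $c\in\mathcal{C}(x_0)$, $x(t)<x_0+tf'(c)$ (resp. $>$) for all small $t>0$. $\mathcal{S}+\mathcal{R}$, $\mathcal{R}+\mathcal{S}$, $\mathcal{S}+\mathcal{R}+\mathcal{S}$ mean that $\mathcal R$ emits from $x_0$ together with a shock emitting from $x_0$ on its left only, on its right only, or on both sides, respectively; $\mathcal{R}$ alone means there is no shock emitting from $x_0$ on either side. *)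

theory Defs
  imports "HOL-Analysis.Analysis"
begin

definition flux_assms :: "(real \<Rightarrow> real) \<Rightarrow> bool" where
  "flux_assms f \<longleftrightarrow>
     (\<forall>s. f differentiable (at s)) \<and> (\<forall>s. deriv f differentiable (at s)) \<and>
     continuous_on UNIV (deriv (deriv f)) \<and>
     (\<forall>s. deriv (deriv f) s \<ge> 0) \<and>
     {s. deriv (deriv f) s = 0} \<in> null_sets lebesgue"

definition L_infinity :: "(real \<Rightarrow> real) \<Rightarrow> bool" where
  "L_infinity \<phi> \<longleftrightarrow>
     \<phi> \<in> borel_measurable lebesgue \<and> (\<exists>B. AE x in lebesgue. \<bar>\<phi> x\<bar> \<le> B)"

text \<open>
  The integrals below are taken with respect to \<open>lebesgue\<close> rather than \<open>lborel\<close>, since \<open>\<phi>\<close> is only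
  assumed Lebesgue measurable; over \<open>lborel\<close> the integral of a non-Borel function is 0 by
  convention. Interval integrals are oriented, so negative \<open>u\<close> and \<open>l\<close> are covered.
\<close>

definition E_fun :: "(real \<Rightarrow> real) \<Rightarrow> (real \<Rightarrow> real) \<Rightarrow> real \<Rightarrow> real \<Rightarrow> real \<Rightarrow> real" where
  "E_fun f \<phi> u x t =
     t * (LINT s=0..ereal u|lebesgue. (deriv (deriv f) s * (\<phi> (x - t * deriv f s) - s)))"

definition maximizers :: "(real \<Rightarrow> real) \<Rightarrow> (real \<Rightarrow> real) \<Rightarrow> real \<Rightarrow> real \<Rightarrow> real set" where
  "maximizers f \<phi> x t = {u. \<forall>v. E_fun f \<phi> v x t \<le> E_fun f \<phi> u x t}"

text \<open>
  The traces \<open>u(x-,t)\<close> and \<open>u(x+,t)\<close> of the entropy solution \<open>u(x,t) = Inf (maximizers f \<phi> x t)\<close>.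
\<close>

definition left_trace :: "(real \<Rightarrow> real) \<Rightarrow> (real \<Rightarrow> real) \<Rightarrow> real \<Rightarrow> real \<Rightarrow> real" where
  "left_trace f \<phi> x t = Sup (maximizers f \<phi> x t)"

definition right_trace :: "(real \<Rightarrow> real) \<Rightarrow> (real \<Rightarrow> real) \<Rightarrow> real \<Rightarrow> real \<Rightarrow> real" where
  "right_trace f \<phi> x t = Inf (maximizers f \<phi> x t)"

definition char_line :: "(real \<Rightarrow> real) \<Rightarrow> real \<Rightarrow> real \<Rightarrow> (real \<times> real) set" where
  "char_line f x0 c = {(x, t). x = x0 + t * deriv f c \<and> t > 0}"

text \<open>The set \<open>\<C>(x0)\<close> of values carried by the characteristics emitting from \<open>x0\<close>.\<close>

definition char_values :: "(real \<Rightarrow> real) \<Rightarrow> (real \<Rightarrow> real) \<Rightarrow> real \<Rightarrow> real set" where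
  "char_values f \<phi> x0 = {c. \<exists>(x, t) \<in> char_line f x0 c. c \<in> maximizers f \<phi> x t}"

definition characteristics ::
    "(real \<Rightarrow> real) \<Rightarrow> (real \<Rightarrow> real) \<Rightarrow> real \<Rightarrow> (real \<times> real) set set" where
  "characteristics f \<phi> x0 = char_line f x0 ` char_values f \<phi> x0"

text \<open>
  The Dini derivatives of \<open>\<Phi>(x) = \<integral>\<^sub>0\<^sup>x \<phi>\<close> at \<open>x0\<close>, with \<open>\<Phi>(x0 + l) - \<Phi>(x0)\<close> written as one
  integral. The limits are formed in the extended reals; they are finite for essentially bounded
  \<open>\<phi>\<close>, so that \<open>real_of_ereal\<close> loses nothing.
\<close>

definition upper_left_Dini :: "(real \<Rightarrow> real) \<Rightarrow> real \<Rightarrow> real" where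
  "upper_left_Dini \<phi> x0 = real_of_ereal
     (Limsup (at_left 0) (\<lambda>l. ereal (1 / l * (LINT \<xi>=ereal x0..ereal (x0 + l)|lebesgue. (\<phi> \<xi>)))))"

definition lower_right_Dini :: "(real \<Rightarrow> real) \<Rightarrow> real \<Rightarrow> real" where
  "lower_right_Dini \<phi> x0 = real_of_ereal
     (Liminf (at_right 0) (\<lambda>l. ereal (1 / l * (LINT \<xi>=ereal x0..ereal (x0 + l)|lebesgue. (\<phi> \<xi>)))))"

definition shock_from ::
    "(real \<Rightarrow> real) \<Rightarrow> (real \<Rightarrow> real) \<Rightarrow> real \<Rightarrow> real \<Rightarrow> (real \<Rightarrow> real) \<Rightarrow> bool" where
  "shock_from f \<phi> x0 T X \<longleftrightarrow>
     T > 0 \<and> continuous_on {0..<T} X \<and> X 0 = x0 \<and>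
     (\<forall>t\<in>{0<..<T}. left_trace f \<phi> (X t) t > right_trace f \<phi> (X t) t)"

definition shock_emits :: "(real \<Rightarrow> real) \<Rightarrow> (real \<Rightarrow> real) \<Rightarrow> real \<Rightarrow> bool" where
  "shock_emits f \<phi> x0 \<longleftrightarrow> (\<exists>T X. shock_from f \<phi> x0 T X)"

definition shock_emits_left :: "(real \<Rightarrow> real) \<Rightarrow> (real \<Rightarrow> real) \<Rightarrow> real \<Rightarrow> bool" where
  "shock_emits_left f \<phi> x0 \<longleftrightarrow>
     (\<exists>T X. shock_from f \<phi> x0 T X \<and>
        (\<forall>c\<in>char_values f \<phi> x0. \<forall>\<^sub>F t in at_right 0. X t < x0 + t * deriv f c))"

definition shock_emits_right :: "(real \<Rightarrow> real) \<Rightarrow> (real \<Rightarrow> real) \<Rightarrow> real \<Rightarrow> bool" where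
  "shock_emits_right f \<phi> x0 \<longleftrightarrow>
     (\<exists>T X. shock_from f \<phi> x0 T X \<and>
        (\<forall>c\<in>char_values f \<phi> x0. \<forall>\<^sub>F t in at_right 0. X t > x0 + t * deriv f c))"

definition rarefaction_emits :: "(real \<Rightarrow> real) \<Rightarrow> (real \<Rightarrow> real) \<Rightarrow> real \<Rightarrow> bool" where
  "rarefaction_emits f \<phi> x0 \<longleftrightarrow>
     is_interval (char_values f \<phi> x0) \<and>
     (\<exists>c\<in>char_values f \<phi> x0. \<exists>d\<in>char_values f \<phi> x0. c < d)"

definition wave_S :: "(real \<Rightarrow> real) \<Rightarrow> (real \<Rightarrow> real) \<Rightarrow> real \<Rightarrow> bool" where
  "wave_S f \<phi> x0 \<longleftrightarrow> shock_emits f \<phi> x0 \<and> characteristics f \<phi> x0 = {}"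

definition wave_characteristic :: "(real \<Rightarrow> real) \<Rightarrow> (real \<Rightarrow> real) \<Rightarrow> real \<Rightarrow> bool" where
  "wave_characteristic f \<phi> x0 \<longleftrightarrow>
     (\<exists>!L. L \<in> characteristics f \<phi> x0) \<and> \<not> shock_emits f \<phi> x0"

definition wave_R :: "(real \<Rightarrow> real) \<Rightarrow> (real \<Rightarrow> real) \<Rightarrow> real \<Rightarrow> bool" where
  "wave_R f \<phi> x0 \<longleftrightarrow>
     rarefaction_emits f \<phi> x0 \<and> \<not> shock_emits_left f \<phi> x0 \<and> \<not> shock_emits_right f \<phi> x0"

definition wave_SR :: "(real \<Rightarrow> real) \<Rightarrow> (real \<Rightarrow> real) \<Rightarrow> real \<Rightarrow> bool" where
  "wave_SR f \<phi> x0 \<longleftrightarrow>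
     rarefaction_emits f \<phi> x0 \<and> shock_emits_left f \<phi> x0 \<and> \<not> shock_emits_right f \<phi> x0"

definition wave_RS :: "(real \<Rightarrow> real) \<Rightarrow> (real \<Rightarrow> real) \<Rightarrow> real \<Rightarrow> bool" where
  "wave_RS f \<phi> x0 \<longleftrightarrow>
     rarefaction_emits f \<phi> x0 \<and> \<not> shock_emits_left f \<phi> x0 \<and> shock_emits_right f \<phi> x0"

definition wave_SRS :: "(real \<Rightarrow> real) \<Rightarrow> (real \<Rightarrow> real) \<Rightarrow> real \<Rightarrow> bool" where
  "wave_SRS f \<phi> x0 \<longleftrightarrow>
     rarefaction_emits f \<phi> x0 \<and> shock_emits_left f \<phi> x0 \<and> shock_emits_right f \<phi> x0"

end

theory Submission
  imports Defs
begin

text \<open>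
  Let \<open>g = f'\<close> and let \<open>\<Phi>\<close> be a primitive of \<open>\<phi>\<close>. The substitution \<open>\<xi> = x - t g(s)\<close> turns \<open>E(u;x,t)\<close>
  into a constant minus \<open>F(u;x,t) = \<Phi>(x - t g(u)) + t H(u)\<close> with \<open>H' = u g'\<close>, so \<open>E\<close> is maximal where
  \<open>F\<close> is minimal. As a function of \<open>g(u)\<close>, \<open>H\<close> is strictly convex with slope \<open>u\<close>; hence
  backward characteristics do not cross, and comparing \<open>\<Phi>\<close> with the tangents of \<open>H\<close> shows that
  \<open>\<C>(x0)\<close> lies between \<open>(a,b)\<close> and \<open>[a,b]\<close>.

  If \<open>\<C>(x0)\<close> has no least element, the curve separating the points with a foot \<open>x - t g(u) < x0\<close>
  from the others is a shock to the left of all characteristics: a minimizer with foot exactly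
  \<open>x0\<close> that is a limit of minimizers with feet below \<open>x0\<close> would have the least value in \<open>\<C>(x0)\<close>.
  If \<open>\<C>(x0)\<close> has a least element, the feet of a shock to its left are below \<open>x0\<close>, and since the
  shock starts at \<open>x0\<close> it can never cross its own backward characteristics, so the intervals between the
  extreme feet at different times are disjoint; but there are uncountably many times. The right-hand side
  follows by the reflection \<open>x \<mapsto> -x\<close>, \<open>u \<mapsto> -u\<close>.
\<close>

section \<open>The variational problem for a Lipschitz potential\<close>

text \<open>Stated with a primitive instead of the data and without \<open>f''\<close>: these
  assumptions survive the reflection used below, and \<open>M\<close> stands for an essential bound
  of the data.\<close>

locale convex_flux =
  fixes f g \<Phi> :: "real \<Rightarrow> real" and M :: real
  assumes deriv_f: "(f has_real_derivative g s) (at s)"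
    and mono_g: "strict_mono g"
    and cont_g: "continuous_on UNIV g"
    and lipschitz_\<Phi>: "\<bar>\<Phi> x - \<Phi> y\<bar> \<le> M * \<bar>x - y\<bar>"
begin

text \<open>This is the Legendre transform of \<open>f\<close> taken at \<open>g u\<close>, so
  \<open>F\<close> is the Hopf-Lax functional with the foot parametrized by
  \<open>u\<close>.\<close>

definition H :: "real \<Rightarrow> real" where
  "H u = u * g u - f u"

definition F :: "real \<Rightarrow> real \<Rightarrow> real \<Rightarrow> real" where
  "F u x t = \<Phi> (x - t * g u) + t * H u"

definition U :: "real \<Rightarrow> real \<Rightarrow> real set" where
  "U x t = {u. \<forall>v. F u x t \<le> F v x t}"

definition C :: "real \<Rightarrow> real set" where
  "C x0 = {c. \<exists>t>0. c \<in> U (x0 + t * g c) t}"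

text \<open>Two distinct minimizers replace the jump of the traces, which avoids infima and suprema;
  \<open>traces_less_iff\<close> supplies the equivalence.\<close>

definition shock :: "real \<Rightarrow> real \<Rightarrow> (real \<Rightarrow> real) \<Rightarrow> bool" where
  "shock x0 T X \<longleftrightarrow> T > 0 \<and> continuous_on {0..<T} X \<and> X 0 = x0 \<and>
     (\<forall>t\<in>{0<..<T}. \<exists>u\<in>U (X t) t. \<exists>v\<in>U (X t) t. u < v)"

section \<open>Monotonicity, continuity and strict convexity\<close>

lemma g_less [simp]: "g u < g v \<longleftrightarrow> u < v"
  by (rule strict_mono_less[OF mono_g])

lemma g_le [simp]: "g u \<le> g v \<longleftrightarrow> u \<le> v"
  by (rule strict_mono_less_eq[OF mono_g])

lemma g_eq [simp]: "g u = g v \<longleftrightarrow> u = v"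
  by (rule strict_mono_eq[OF mono_g])

lemma M_nonneg: "0 \<le> M"
  using order_trans[OF abs_ge_zero lipschitz_\<Phi>[of 1 0]] by simp

lemma continuous_f: "continuous_on UNIV f"
  using deriv_f by (meson DERIV_isCont continuous_at_imp_continuous_on)

lemma continuous_\<Phi>: "continuous_on UNIV \<Phi>"
proof -
  have "M-lipschitz_on UNIV \<Phi>"
    by (rule lipschitz_onI) (use lipschitz_\<Phi> M_nonneg in \<open>auto simp: dist_real_def\<close>)
  then show ?thesis by (rule lipschitz_on_continuous_on)
qed

lemma tendsto_g: "(h \<longlongrightarrow> l) N \<Longrightarrow> ((\<lambda>n. g (h n)) \<longlongrightarrow> g l) N"
  using cont_g by (metis continuous_on_eq_continuous_at isCont_tendsto_compose open_UNIV UNIV_I)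

lemma tendsto_f: "(h \<longlongrightarrow> l) N \<Longrightarrow> ((\<lambda>n. f (h n)) \<longlongrightarrow> f l) N"
  using continuous_f by (metis continuous_on_eq_continuous_at isCont_tendsto_compose open_UNIV UNIV_I)

lemma tendsto_\<Phi>: "(h \<longlongrightarrow> l) N \<Longrightarrow> ((\<lambda>n. \<Phi> (h n)) \<longlongrightarrow> \<Phi> l) N"
  using continuous_\<Phi> by (metis continuous_on_eq_continuous_at isCont_tendsto_compose open_UNIV UNIV_I)

lemma tendsto_F:
  assumes "(h \<longlongrightarrow> u) N" "(k \<longlongrightarrow> x) N"
  shows "((\<lambda>n. F (h n) (k n) t) \<longlongrightarrow> F u x t) N"
  unfolding F_def H_def by (intro tendsto_intros tendsto_\<Phi> tendsto_g tendsto_f assms)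

text \<open>The gap between the two sides is \<open>(v - w) * g v - (f v - f w)\<close>. The mean
  value theorem turns it into \<open>(v - w) * (g v - g z)\<close> with \<open>z\<close> strictly
  between \<open>v\<close> and \<open>w\<close>, which is positive since \<open>g\<close>
  increases.\<close>

lemma H_gradient:
  assumes "v \<noteq> w"
  shows "H v - H w > w * (g v - g w)"
proof (cases "v < w")
  case True
  obtain z where z: "v < z" "f w - f v = (w - v) * g z"
    using MVT2[OF True, of f g] deriv_f by blast
  have "(w - v) * (g z - g v) > 0" using True z by simp
  then show ?thesis using z by (simp add: H_def algebra_simps)
next
  case False
  then have wv: "w < v" using assms by simp
  obtain z where z: "z < v" "f v - f w = (v - w) * g z"
    using MVT2[OF wv, of f g] deriv_f by blast
  have "(v - w) * (g v - g z) > 0" using wv z by simp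
  then show ?thesis using z by (simp add: H_def algebra_simps)
qed

lemma H_gradient_le: "H v - H w \<ge> w * (g v - g w)"
  using H_gradient[of v w] by (cases "v = w") auto

text \<open>Average the strict supporting line at \<open>w\<close> over \<open>u\<close> and
  \<open>v\<close>: its linear part cancels because \<open>g w\<close> is the same average of
  \<open>g u\<close> and \<open>g v\<close>.\<close>

lemma H_convex:
  assumes "0 < l" "l < 1" "u \<noteq> v" "g w = (1 - l) * g u + l * g v"
  shows "H w < (1 - l) * H u + l * H v"
proof -
  have "g w - g u = l * (g v - g u)" "g w - g v = (1 - l) * (g u - g v)"
    using assms(4) by (auto simp: algebra_simps)
  then have "g w - g u \<noteq> 0" "g w - g v \<noteq> 0" using assms(1-3) by auto
  then have "w \<noteq> u" "w \<noteq> v" by auto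
  then have 1: "H u - H w > w * (g u - g w)" and 2: "H v - H w > w * (g v - g w)"
    by (auto intro!: H_gradient)
  have "(1 - l) * (H u - H w) + l * (H v - H w)
      > (1 - l) * (w * (g u - g w)) + l * (w * (g v - g w))"
    using assms(1,2) 1 2 by (intro add_strict_mono mult_strict_left_mono) auto
  moreover have "(1 - l) * (w * (g u - g w)) + l * (w * (g v - g w)) = 0"
    unfolding assms(4) by (simp add: algebra_simps)
  ultimately show ?thesis by (simp add: algebra_simps)
qed

text \<open>The range of \<open>g\<close> need not be the whole line, but it is an interval, so a
  speed between two attained ones is attained.\<close>

lemma g_interpolate:
  assumes "0 \<le> l" "l \<le> 1"
  obtains w where "g w = (1 - l) * g u + l * g v"
proof -
  have "convex (range g)"
    using connected_continuous_image[OF cont_g connected_UNIV]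
    by (simp add: is_interval_connected_1 is_interval_convex_1[symmetric])
  then have "(1 - l) *\<^sub>R g u + l *\<^sub>R g v \<in> range g"
    using assms unfolding convex_alt by blast
  then show ?thesis using that by auto
qed

lemma g_between:
  assumes "g u \<le> q" "q \<le> g v"
  obtains w where "g w = q" "u \<le> w" "w \<le> v"
proof -
  have "u \<le> v" using assms by (meson g_le order_trans)
  obtain w where "w \<ge> u" "w \<le> v" "g w = q"
    using IVT'[of g u q v] assms \<open>u \<le> v\<close> continuous_on_subset[OF cont_g] by auto
  then show ?thesis using that by blast
qed

section \<open>Bounds, existence and limits of minimizers\<close>

lemma F_less_above:
  assumes "t > 0" "u > M"
  shows "F M x t < F u x t"
proof -
  have "\<bar>\<Phi> (x - t * g u) - \<Phi> (x - t * g M)\<bar> \<le> M * (t * (g u - g M))"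
    using lipschitz_\<Phi>[of "x - t * g u" "x - t * g M"] assms
    by (simp add: abs_mult right_diff_distrib[symmetric] abs_minus_commute)
  \<comment> \<open>The supporting line at \<open>M\<close> has slope \<open>M\<close> with respect
    to \<open>g\<close>, which offsets the Lipschitz bound on \<open>\<Phi>\<close>; the strictness
    comes from \<open>H\<close>.\<close>
  moreover have "t * (H u - H M) > t * (M * (g u - g M))"
    using assms H_gradient[of u M] by (intro mult_strict_left_mono) auto
  ultimately show ?thesis unfolding F_def by (auto simp: algebra_simps)
qed

lemma F_less_below:
  assumes "t > 0" "u < - M"
  shows "F (- M) x t < F u x t"
proof -
  have "\<bar>\<Phi> (x - t * g u) - \<Phi> (x - t * g (-M))\<bar> \<le> M * (t * (g (-M) - g u))"
    using lipschitz_\<Phi>[of "x - t * g u" "x - t * g (-M)"] assms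
    by (simp add: abs_mult right_diff_distrib[symmetric])
  moreover have "t * (H u - H (-M)) > t * ((-M) * (g u - g (-M)))"
    using assms H_gradient[of u "-M"] by (intro mult_strict_left_mono) auto
  ultimately show ?thesis unfolding F_def by (auto simp: algebra_simps)
qed

text \<open>The bound is uniform in \<open>x\<close> and \<open>t\<close>. It provides the
  compactness behind existence and limits of minimizers, and the finite propagation speed.\<close>

lemma U_bounded:
  assumes "t > 0" "u \<in> U x t"
  shows "\<bar>u\<bar> \<le> M"
  using F_less_above[OF assms(1), of u x] F_less_below[OF assms(1), of u x] assms(2)
  unfolding U_def by (force simp: not_less[symmetric])

lemma U_I:
  assumes "t > 0" "\<And>v. \<bar>v\<bar> \<le> M \<Longrightarrow> F u x t \<le> F v x t"
  shows "u \<in> U x t"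
proof -
  have "F u x t \<le> F v x t" for v
    using F_less_above[OF assms(1), of v x] F_less_below[OF assms(1), of v x] assms(2)[of v]
      assms(2)[of M] assms(2)[of "-M"] M_nonneg by (cases "v > M"; cases "v < - M") auto
  then show ?thesis unfolding U_def by simp
qed

lemma U_nonempty:
  assumes "t > 0"
  shows "U x t \<noteq> {}"
proof -
  have "continuous_on {-M..M} (\<lambda>u. F u x t)"
    unfolding continuous_on_def by (intro ballI tendsto_F tendsto_ident_at tendsto_const)
  then obtain u where "u \<in> {-M..M}" "\<forall>v\<in>{-M..M}. F u x t \<le> F v x t"
    using continuous_attains_inf[of "{-M..M}" "\<lambda>u. F u x t"] M_nonneg by auto
  then have "u \<in> U x t" by (intro U_I assms) (simp add: abs_le_iff minus_le_iff)
  then show ?thesis by blast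
qed

text \<open>Compactness of \<open>{-M..M}\<close> and continuity of \<open>F\<close> at fixed time;
  used to approach a point of a shock curve from either side.\<close>

lemma U_limit:
  assumes "t > 0" "\<And>n. u n \<in> U (x n) t" "x \<longlonglongrightarrow> (z::real)"
  obtains w r where "strict_mono (r :: nat \<Rightarrow> nat)" "(u \<circ> r) \<longlonglongrightarrow> w" "w \<in> U z t"
proof -
  have "\<forall>n. u n \<in> {-M..M}" using U_bounded[OF assms(1,2)] by (auto simp: abs_le_iff minus_le_iff)
  then obtain w r where r: "strict_mono (r :: nat \<Rightarrow> nat)" "(u \<circ> r) \<longlonglongrightarrow> w"
    using compact_Icc[of "-M" M, unfolded compact_def] by metis
  have x: "(x \<circ> r) \<longlonglongrightarrow> z" using assms(3) r(1) by (rule LIMSEQ_subseq_LIMSEQ)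
  have "F w z t \<le> F v z t" for v
  proof (rule LIMSEQ_le)
    show "(\<lambda>n. F ((u \<circ> r) n) ((x \<circ> r) n) t) \<longlonglongrightarrow> F w z t" by (intro tendsto_F r x)
    show "(\<lambda>n. F v ((x \<circ> r) n) t) \<longlonglongrightarrow> F v z t" by (intro tendsto_F tendsto_const x)
    show "\<exists>N. \<forall>n\<ge>N. F ((u \<circ> r) n) ((x \<circ> r) n) t \<le> F v ((x \<circ> r) n) t"
      using assms(2) unfolding U_def by auto
  qed
  then have "w \<in> U z t" unfolding U_def by simp
  then show ?thesis using that r by blast
qed

section \<open>Backward characteristics do not cross\<close>

lemma U_line_F:
  assumes "u \<in> U (y + t * g u) t"
  shows "\<Phi> y + t * H u \<le> \<Phi> (y + t * (g u - g v)) + t * H v"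
  using assms unfolding U_def F_def by (auto simp: algebra_simps)

text \<open>A competitor at the earlier time \<open>s\<close> that costs no more could be extended
  to time \<open>t\<close> along the line of \<open>u\<close>. Replacing the resulting broken path
  by a straight one with the same foot strictly lowers the cost, against the minimality of
  \<open>u\<close> at \<open>t\<close>.\<close>

lemma U_line_unique:
  assumes "0 < s" "s < t" "u \<in> U (y + t * g u) t"
  shows "U (y + s * g u) s = {u}"
proof -
  have less: "F u (y + s * g u) s < F v (y + s * g u) s" if "v \<noteq> u" for v
  proof -
    \<comment> \<open>The speed \<open>g w\<close> is the mean speed of the broken path:
      \<open>g v\<close> up to time \<open>s\<close>, then \<open>g u\<close> up to time
      \<open>t\<close>.\<close>
    obtain w where w: "g w = (1 - s/t) * g u + (s/t) * g v"
      by (rule g_interpolate[of "s/t" u v]) (use assms in auto)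
    have "H w < (1 - s/t) * H u + (s/t) * H v"
      using assms that w by (intro H_convex) auto
    then have "t * H w < t * ((1 - s/t) * H u + (s/t) * H v)" using assms by simp
    also have "\<dots> = t * H u - s * H u + s * H v" using assms by (simp add: field_simps)
    finally have 1: "t * H w < t * H u - s * H u + s * H v" .
    have "t * (g u - g w) = s * (g u - g v)" unfolding w using assms by (simp add: field_simps)
    then have "\<Phi> y + t * H u \<le> \<Phi> (y + s * (g u - g v)) + t * H w"
      using U_line_F[OF assms(3), of w] by simp
    then show ?thesis using 1 unfolding F_def by (simp add: algebra_simps)
  qed
  then have "u \<in> U (y + s * g u) s" unfolding U_def by (smt (verit) mem_Collect_eq)
  moreover have "v = u" if "v \<in> U (y + s * g u) s" for v
    using less[of v] that unfolding U_def by (smt (verit) mem_Collect_eq)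
  ultimately show ?thesis by blast
qed

text \<open>An exchange argument: if the feet were in reversed order, exchanging them would leave
  the sum of the \<open>\<Phi>\<close> terms unchanged and strictly lower the sum of the
  \<open>H\<close> terms by convexity, so one of the two values would not be minimal.\<close>

lemma feet_mono:
  assumes "t > 0" "x1 < x2" "u1 \<in> U x1 t" "u2 \<in> U x2 t"
  shows "x1 - t * g u1 \<le> x2 - t * g u2"
proof (rule ccontr)
  define y1 y2 where "y1 = x1 - t * g u1" and "y2 = x2 - t * g u2"
  assume "\<not> ?thesis"
  then have y: "y2 < y1" unfolding y1_def y2_def by simp
  define d where "d = (x2 - y2) - (x1 - y1)"
  have d: "d > 0" "d = t * (g u2 - g u1)" using y assms(2) unfolding d_def y1_def y2_def
    by (auto simp: algebra_simps)
  then have ne: "u1 \<noteq> u2" by auto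
  \<comment> \<open>The weight is chosen so that speed \<open>g w\<close> leads from
    \<open>y2\<close> to \<open>x1\<close>; the complementary weight gives \<open>w'\<close>,
    leading from \<open>y1\<close> to \<open>x2\<close>.\<close>
  define l where "l = (y1 - y2) / d"
  have l: "0 < l" "l < 1" using y d assms(2) unfolding l_def by (auto simp: d_def)
  have ld: "l * d = y1 - y2" unfolding l_def using d(1) by simp
  obtain w where w: "g w = (1 - l) * g u1 + l * g u2"
    by (rule g_interpolate[of l u1 u2]) (use l in auto)
  obtain w' where w': "g w' = (1 - l) * g u2 + l * g u1"
    by (rule g_interpolate[of l u2 u1]) (use l in auto)
  have "H w < (1 - l) * H u1 + l * H u2" "H w' < (1 - l) * H u2 + l * H u1"
    using l w w' ne by (auto intro!: H_convex)
  then have H: "H w + H w' < H u1 + H u2" by (simp add: algebra_simps)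
  have "t * g w = t * g u1 + l * d" unfolding w d(2) by (simp add: algebra_simps)
  then have yw: "x1 - t * g w = y2" using ld by (simp add: y1_def)
  have "t * g w' = t * g u2 - l * d" unfolding w' d(2) by (simp add: algebra_simps)
  then have yw': "x2 - t * g w' = y1" using ld by (simp add: y2_def)
  have "F u1 x1 t \<le> F w x1 t" "F u2 x2 t \<le> F w' x2 t" using assms(3,4) unfolding U_def by auto
  then have "t * (H u1 + H u2) \<le> t * (H w + H w')"
    unfolding F_def yw yw' y1_def[symmetric] y2_def[symmetric] by (simp add: algebra_simps)
  then show False using H assms(1) by simp
qed

section \<open>Emitted values and difference quotients of the potential\<close>

lemma C_E:
  assumes "c \<in> C x0"
  obtains T where "T > 0" "\<And>t. 0 < t \<Longrightarrow> t < T \<Longrightarrow> U (x0 + t * g c) t = {c}"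
  using assms U_line_unique unfolding C_def by blast

lemma C_I:
  assumes "t > 0" "u \<in> U x t" "x - t * g u = x0"
  shows "u \<in> C x0"
  unfolding C_def using assms by (auto intro!: exI[of _ t] simp: algebra_simps)

lemma speed_bound:
  obtains K where "\<And>t u x. t > 0 \<Longrightarrow> u \<in> U x t \<Longrightarrow> \<bar>g u\<bar> \<le> K" "K > 0"
proof
  fix t u x :: real assume "t > 0" "u \<in> U x t"
  from U_bounded[OF this] have "- M \<le> u" "u \<le> M" by auto
  then have "g (-M) \<le> g u" "g u \<le> g M" by auto
  then show "\<bar>g u\<bar> \<le> \<bar>g M\<bar> + \<bar>g (-M)\<bar> + 1" by linarith
qed auto

text \<open>Compare \<open>c\<close> with the value \<open>v\<close> whose foot is
  \<open>x0 + l\<close>. Minimality bounds the increment of \<open>\<Phi>\<close> below by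
  \<open>t * (H c - H v)\<close>, and the supporting line at \<open>v\<close>, rather than at
  \<open>c\<close>, turns this into \<open>v * l\<close> with \<open>v\<close> close to
  \<open>c\<close>.\<close>

lemma difference_quotient_right:
  assumes "c \<in> C x0" "e > 0"
  shows "\<forall>\<^sub>F l in at_right 0. \<Phi> (x0 + l) - \<Phi> x0 \<ge> (c - e) * l"
proof -
  obtain t where t: "t > 0" "c \<in> U (x0 + t * g c) t" using assms unfolding C_def by blast
  \<comment> \<open>The upper limit for \<open>l\<close> is the displacement of the foot when
    \<open>c\<close> is lowered to \<open>c - e\<close>.\<close>
  have "\<Phi> (x0 + l) - \<Phi> x0 \<ge> (c - e) * l" if l: "l \<in> {0<..<t * (g c - g (c - e))}" for l
  proof -
    have "g (c - e) \<le> g c - l / t" "g c - l / t \<le> g c" using l t by (auto simp: field_simps)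
    then obtain v where v: "g v = g c - l / t" "c - e \<le> v" using g_between by metis
    have lv: "t * (g c - g v) = l" using v t by simp
    have "\<Phi> x0 + t * H c \<le> \<Phi> (x0 + l) + t * H v"
      using U_line_F[OF t(2), of v] lv by simp
    moreover have "t * (H c - H v) \<ge> t * (v * (g c - g v))"
      using H_gradient_le[of v c] t by (intro mult_left_mono H_gradient_le) auto
    moreover have "t * (v * (g c - g v)) = v * l" using lv by (simp add: mult.left_commute)
    moreover have "v * l \<ge> (c - e) * l" using v l by (intro mult_right_mono) auto
    ultimately show ?thesis by (simp add: algebra_simps)
  qed
  moreover have "\<forall>\<^sub>F l in at_right 0. l \<in> {0<..<t * (g c - g (c - e))}"
    using t assms by (intro eventually_at_right_real) auto
  ultimately show ?thesis by (rule eventually_mono[rotated])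
qed

text \<open>The linear lower bound on \<open>\<Phi>\<close> cancels against the supporting line of
  \<open>H\<close> at \<open>c\<close>. Both apply to all relevant competitors once \<open>t\<close>
  is small, since only values in \<open>{-M..M}\<close> have to be compared.\<close>

lemma mem_C_I:
  assumes "\<bar>c\<bar> \<le> M" "\<forall>\<^sub>F l in at 0. \<Phi> (x0 + l) - \<Phi> x0 \<ge> c * l"
  shows "c \<in> C x0"
proof -
  obtain d where d: "d > 0" "\<And>l. l \<noteq> 0 \<Longrightarrow> \<bar>l\<bar> < d \<Longrightarrow> \<Phi> (x0 + l) - \<Phi> x0 \<ge> c * l"
    using assms(2) unfolding eventually_at by (auto simp: dist_real_def)
  \<comment> \<open>With this time all feet belonging to values in \<open>{-M..M}\<close> lie within
    \<open>d\<close> of \<open>x0\<close>; the summand 1 keeps the denominator positive and the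
    estimate strict.\<close>
  define t where "t = d / (g M - g (-M) + 1)"
  have pos: "g M - g (-M) + 1 > 0" using M_nonneg by (smt (verit) g_le)
  then have t: "t > 0" "t * (g M - g (-M) + 1) = d" using d unfolding t_def by auto
  have "c \<in> U (x0 + t * g c) t"
  proof (rule U_I[OF t(1)])
    fix v assume v: "\<bar>v\<bar> \<le> M"
    define l where "l = t * (g c - g v)"
    have "- M \<le> v" "v \<le> M" "- M \<le> c" "c \<le> M" using v assms(1) by auto
    then have "\<bar>g c - g v\<bar> \<le> g M - g (-M)" by (smt (verit) g_le)
    then have "t * \<bar>g c - g v\<bar> < t * (g M - g (-M) + 1)"
      using t(1) by (intro mult_strict_left_mono) auto
    then have "\<bar>l\<bar> < d" using t unfolding l_def by (simp add: abs_mult)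
    then have "\<Phi> (x0 + l) - \<Phi> x0 \<ge> c * l" using d(2)[of l] by (cases "l = 0") auto
    moreover have "t * (H v - H c) \<ge> t * (c * (g v - g c))"
      using t by (intro mult_left_mono H_gradient_le) auto
    ultimately show "F c (x0 + t * g c) t \<le> F v (x0 + t * g c) t"
      unfolding F_def l_def by (simp add: algebra_simps)
  qed
  then show ?thesis using t unfolding C_def by blast
qed

section \<open>Shocks on the left of the characteristics\<close>

text \<open>If \<open>C x0\<close> is empty, the hypothesis holds vacuously, so the same
  construction yields the shock without characteristics.\<close>

lemma left_shock:
  assumes no_min: "\<And>u. u \<in> C x0 \<Longrightarrow> \<exists>c\<in>C x0. c < u"
  obtains X where "\<And>T. T > 0 \<Longrightarrow> shock x0 T X"
    "\<And>c. c \<in> C x0 \<Longrightarrow> \<forall>\<^sub>F t in at_right 0. X t < x0 + t * g c"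
proof -
  obtain K where K: "\<And>t u x. t > 0 \<Longrightarrow> u \<in> U x t \<Longrightarrow> \<bar>g u\<bar> \<le> K" "K > 0"
    using speed_bound by blast
  have foot_near: "\<bar>t * g u\<bar> \<le> t * K" if "t > 0" "u \<in> U x t" for t u x
    using K(1)[OF that] that by (simp add: abs_mult)
  \<comment> \<open>\<open>A t\<close> consists of the points reached from feet below
    \<open>x0\<close>; its right end is the shock position.\<close>
  define A where "A t = {x. \<exists>u\<in>U x t. x - t * g u < x0}" for t
  define X where "X t = (if t = 0 then x0 else Sup (A t))" for t
  have A_bdd: "bdd_above (A t)" if "t > 0" for t
  proof (rule bdd_aboveI)
    fix x assume "x \<in> A t"
    then obtain u where "u \<in> U x t" "x - t * g u < x0" unfolding A_def by blast
    then show "x \<le> x0 + t * K" using foot_near[OF that] by fastforce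
  qed
  have A_ne: "A t \<noteq> {}" if "t > 0" for t
  proof -
    define x where "x = x0 - t * K - 1"
    obtain u where u: "u \<in> U x t" using U_nonempty[OF \<open>t > 0\<close>] by blast
    then have "x - t * g u < x0" using foot_near[OF that u] unfolding x_def by linarith
    then show ?thesis using u unfolding A_def by blast
  qed
  have X_ge: "x \<le> X t" if "t > 0" "u \<in> U x t" "x - t * g u < x0" for x u t
    using cSup_upper[OF _ A_bdd[OF that(1)], of x] that unfolding X_def A_def by auto
  have X_le: "X t \<le> x" if "t > 0" "u \<in> U x t" "x - t * g u \<ge> x0" "U x t = {u}" for x u t
  proof -
    have "z \<le> x" if zA: "z \<in> A t" for z
    proof (rule ccontr)
      assume "\<not> z \<le> x"
      moreover obtain v where "v \<in> U z t" "z - t * g v < x0"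
        using zA unfolding A_def by blast
      ultimately show False using feet_mono[OF \<open>t > 0\<close>, of x z u v] \<open>u \<in> U x t\<close> \<open>x - t * g u \<ge> x0\<close>
        by simp
    qed
    then show ?thesis using cSup_least[OF A_ne[OF \<open>t > 0\<close>]] \<open>t > 0\<close> unfolding X_def by simp
  qed
  have left: "\<exists>u\<in>U (X t) t. X t - t * g u < x0" if t: "t > 0" for t
  proof -
    \<comment> \<open>Minimizers at points of \<open>A t\<close> tending to \<open>X t\<close> have
      a limit whose foot is at most \<open>x0\<close>. It remains to exclude equality, which is
      where the missing minimum is used.\<close>
    have "X t \<in> closure (A t)" using closure_contains_Sup[OF A_ne A_bdd] t unfolding X_def by simp
    then obtain x where x: "\<And>n. x n \<in> A t" "x \<longlonglongrightarrow> X t" unfolding closure_sequential by blast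
    then have "\<forall>n. \<exists>v. v \<in> U (x n) t \<and> x n - t * g v < x0" unfolding A_def by blast
    from choice[OF this] obtain u where
      u: "\<And>n. u n \<in> U (x n) t" "\<And>n. x n - t * g (u n) < x0" by blast
    obtain w r where r: "strict_mono (r :: nat \<Rightarrow> nat)" "(u \<circ> r) \<longlonglongrightarrow> w" "w \<in> U (X t) t"
      using U_limit[OF t u(1) x(2)] by blast
    have xr: "(x \<circ> r) \<longlonglongrightarrow> X t" using x(2) r(1) by (rule LIMSEQ_subseq_LIMSEQ)
    have gr: "(\<lambda>n. g ((u \<circ> r) n)) \<longlonglongrightarrow> g w" by (rule tendsto_g[OF r(2)])
    have "(\<lambda>n. (x \<circ> r) n - t * g ((u \<circ> r) n)) \<longlonglongrightarrow> X t - t * g w"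
      by (intro tendsto_intros xr gr)
    then have "X t - t * g w \<le> x0"
      by (rule LIMSEQ_le_const2) (use u(2) in \<open>auto intro!: less_imp_le\<close>)
    moreover have "X t - t * g w \<noteq> x0"
    proof
      assume eq: "X t - t * g w = x0"
      then obtain c where c: "c \<in> C x0" "c < w" using no_min C_I[OF t r(3)] by blast
      obtain T where T: "T > 0" "\<And>t. 0 < t \<Longrightarrow> t < T \<Longrightarrow> U (x0 + t * g c) t = {c}"
        using C_E[OF c(1)] by blast
      \<comment> \<open>Before time \<open>T\<close> the characteristics with feet below \<open>x0\<close> stay left of \<open>L\<^sub>c(x0)\<close>, but they
        converge to the faster \<open>L\<^sub>w(x0)\<close>.\<close>
      define s where "s = min t T / 2"
      have s: "0 < s" "s < t" "s < T" using t T unfolding s_def by auto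
      have "x n - (t - s) * g (u n) \<le> x0 + s * g c" for n
      proof (rule ccontr)
        assume n: "\<not> ?thesis"
        have e: "x n - (t - s) * g (u n) = (x n - t * g (u n)) + s * g (u n)"
          by (simp add: algebra_simps)
        have "U (x n - (t - s) * g (u n)) s = {u n}"
          unfolding e using s u(1)[of n] by (intro U_line_unique[of s t]) auto
        then have "x0 + s * g c - s * g c \<le> x n - (t - s) * g (u n) - s * g (u n)"
          using n s T(2)[of s] by (intro feet_mono) auto
        then show False using u(2)[of n] by (simp add: algebra_simps)
      qed
      moreover have "(\<lambda>n. (x \<circ> r) n - (t - s) * g ((u \<circ> r) n)) \<longlonglongrightarrow> X t - (t - s) * g w"
        by (intro tendsto_intros xr gr)
      ultimately have "X t - (t - s) * g w \<le> x0 + s * g c"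
        by (intro LIMSEQ_le_const2) auto
      then have "s * g w \<le> s * g c" using eq by (simp add: algebra_simps)
      then show False using s c by simp
    qed
    ultimately show ?thesis using r(3) by force
  qed
  have right: "\<exists>u\<in>U (X t) t. X t - t * g u \<ge> x0" if t: "t > 0" for t
  proof -
    \<comment> \<open>Points to the right of \<open>X t\<close> are outside \<open>A t\<close>, so
      all their feet are at least \<open>x0\<close>, and this passes to the limit.\<close>
    define x where "x n = X t + inverse (real (Suc n))" for n
    have x: "x \<longlonglongrightarrow> X t" unfolding x_def by (rule LIMSEQ_inverse_real_of_nat_add)
    have "\<forall>n. \<exists>v. v \<in> U (x n) t" using U_nonempty[OF t] by blast
    from choice[OF this] obtain u where u: "\<And>n. u n \<in> U (x n) t" by blast
    have ge: "x n - t * g (u n) \<ge> x0" for n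
      using X_ge[OF t u[of n]] unfolding x_def by (force simp: not_less[symmetric])
    obtain w r where r: "strict_mono (r :: nat \<Rightarrow> nat)" "(u \<circ> r) \<longlonglongrightarrow> w" "w \<in> U (X t) t"
      using U_limit[OF t u x] by blast
    have xr: "(x \<circ> r) \<longlonglongrightarrow> X t" using x r(1) by (rule LIMSEQ_subseq_LIMSEQ)
    have "(\<lambda>n. (x \<circ> r) n - t * g ((u \<circ> r) n)) \<longlonglongrightarrow> X t - t * g w"
      by (intro tendsto_intros xr tendsto_g[OF r(2)])
    then have "X t - t * g w \<ge> x0"
      by (rule LIMSEQ_le_const) (use ge in auto)
    then show ?thesis using r(3) by blast
  qed
  \<comment> \<open>The two backward characteristics from \<open>X t\<close>, with feet on either
    side of \<open>x0\<close>, enclose \<open>X s\<close> at the earlier time, and their speeds are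
    at most \<open>K\<close>.\<close>
  have lip_less: "\<bar>X s - X t\<bar> \<le> K * \<bar>s - t\<bar>" if st: "0 < s" "s < t" for s t
  proof -
    have t: "t > 0" using st by simp
    obtain u where u: "u \<in> U (X t) t" "X t - t * g u < x0" using left t by blast
    obtain v where v: "v \<in> U (X t) t" "X t - t * g v \<ge> x0" using right t by blast
    have *: "U (X t - (t - s) * g w) s = {w}" if "w \<in> U (X t) t" for w
      using U_line_unique[of s t w "X t - t * g w"] that st by (simp add: algebra_simps)
    have "X t - (t - s) * g u \<le> X s"
      by (rule X_ge[of s u]) (use *[OF u(1)] st u in \<open>auto simp: algebra_simps\<close>)
    moreover have "X s \<le> X t - (t - s) * g v"
      by (rule X_le[of s v]) (use *[OF v(1)] st v in \<open>auto simp: algebra_simps\<close>)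
    moreover have "(t - s) * g u \<le> (t - s) * K" "(t - s) * (- K) \<le> (t - s) * g v"
      using K(1)[OF t u(1)] K(1)[OF t v(1)] st by (intro mult_left_mono; simp)+
    ultimately show ?thesis using st by (simp add: algebra_simps abs_le_iff)
  qed
  have lip_0: "\<bar>X t - X 0\<bar> \<le> K * \<bar>t - 0\<bar>" if t: "t > 0" for t
  proof -
    obtain u where u: "u \<in> U (X t) t" "X t - t * g u < x0" using left t by blast
    obtain v where v: "v \<in> U (X t) t" "X t - t * g v \<ge> x0" using right t by blast
    have "\<bar>X t - x0\<bar> \<le> t * K"
      using u v foot_near[OF t u(1)] foot_near[OF t v(1)] unfolding abs_le_iff by linarith
    moreover have "X 0 = x0" unfolding X_def by simp
    ultimately show ?thesis using t by (simp add: mult.commute)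
  qed
  have lip: "\<bar>X s - X t\<bar> \<le> K * \<bar>s - t\<bar>" if "0 \<le> s" "0 \<le> t" for s t
  proof -
    consider "s = t" | "s = 0" "t > 0" | "t = 0" "s > 0" | "0 < s" "s < t" | "0 < t" "t < s"
      using \<open>0 \<le> s\<close> \<open>0 \<le> t\<close> by linarith
    then show ?thesis
    proof cases
      case 2 then show ?thesis using lip_0[of t] by (simp add: abs_minus_commute)
    next
      case 3 then show ?thesis using lip_0[of s] by simp
    next
      case 4 then show ?thesis using lip_less[of s t] by simp
    next
      case 5 then show ?thesis using lip_less[of t s] by (simp add: abs_minus_commute)
    qed simp
  qed
  have "K-lipschitz_on {0..} X"
    by (rule lipschitz_onI) (use lip K in \<open>auto simp: dist_real_def\<close>)
  then have cont: "continuous_on {0..} X" by (rule lipschitz_on_continuous_on)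
  show thesis
  proof
    show "shock x0 T X" if "T > 0" for T
      unfolding shock_def
    proof (intro conjI ballI)
      show "continuous_on {0..<T} X" by (rule continuous_on_subset[OF cont]) auto
      show "X 0 = x0" unfolding X_def by simp
      fix t assume "t \<in> {0<..<T}"
      then have t: "t > 0" by simp
      obtain u where u: "u \<in> U (X t) t" "X t - t * g u < x0" using left t by blast
      obtain v where v: "v \<in> U (X t) t" "X t - t * g v \<ge> x0" using right t by blast
      have "t * g v < t * g u" using u v by simp
      then have "v < u" using t by simp
      then show "\<exists>u\<in>U (X t) t. \<exists>v\<in>U (X t) t. u < v" using u v by blast
    qed (use that in simp)
    show "\<forall>\<^sub>F t in at_right 0. X t < x0 + t * g c" if "c \<in> C x0" for c
    proof -
      \<comment> \<open>A smaller value \<open>d\<close> is inserted to get a strict inequality: the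
        shock is only known to stay weakly left of \<open>L_d\<close>.\<close>
      obtain d where d: "d \<in> C x0" "d < c" using no_min \<open>c \<in> C x0\<close> by blast
      obtain T where T: "T > 0" "\<And>t. 0 < t \<Longrightarrow> t < T \<Longrightarrow> U (x0 + t * g d) t = {d}"
        using C_E[OF d(1)] by blast
      have "X t < x0 + t * g c" if t: "t \<in> {0<..<T}" for t
      proof -
        have "X t \<le> x0 + t * g d"
          by (rule X_le[of t d]) (use t T(2)[of t] in auto)
        also have "\<dots> < x0 + t * g c" using t d by simp
        finally show ?thesis .
      qed
      moreover have "\<forall>\<^sub>F t in at_right 0. t \<in> {0<..<T}"
        using T(1) by (rule eventually_at_right_real)
      ultimately show ?thesis by (rule eventually_mono[rotated])
    qed
  qed
qed

text \<open>Two minimizers chosen at each time span an open interval of feet. These intervals move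
  to the left as time grows without overlapping, so rational points chosen in them would inject an
  interval of times into a countable set.\<close>

lemma no_left_shock:
  assumes c: "c \<in> C x0" "\<And>u. u \<in> C x0 \<Longrightarrow> c \<le> u"
    and X: "shock x0 T X" "\<forall>\<^sub>F t in at_right 0. X t < x0 + t * g c"
  shows False
proof -
  obtain T1 where T1: "T1 > 0" "\<And>t. 0 < t \<Longrightarrow> t < T1 \<Longrightarrow> U (x0 + t * g c) t = {c}"
    using C_E[OF c(1)] by blast
  obtain T2 where T2: "T2 > 0" "\<And>t. 0 < t \<Longrightarrow> t < T2 \<Longrightarrow> X t < x0 + t * g c"
    using X(2) unfolding eventually_at_right_field by auto
  define S where "S = min T (min T1 T2)"
  have S: "S > 0" "S \<le> T" "S \<le> T1" "S \<le> T2" using X(1) T1(1) T2(1) unfolding S_def shock_def by auto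
  have "\<exists>p. fst p \<in> U (X t) t \<and> snd p \<in> U (X t) t \<and> fst p < snd p" if "t \<in> {0<..<S}" for t
    using X(1) that S unfolding shock_def by fastforce
  then obtain p where p: "\<And>t. t \<in> {0<..<S} \<Longrightarrow>
      fst (p t) \<in> U (X t) t \<and> snd (p t) \<in> U (X t) t \<and> fst (p t) < snd (p t)" by metis
  define lo hi where "lo t = fst (p t)" and "hi t = snd (p t)" for t
  have U_lo: "lo t \<in> U (X t) t" and U_hi: "hi t \<in> U (X t) t" and lohi: "lo t < hi t"
    if "t \<in> {0<..<S}" for t using p[OF that] unfolding lo_def hi_def by auto
  \<comment> \<open>The smaller value has the larger foot, hence \<open>yr\<close> belongs to
    \<open>lo\<close>.\<close>
  define yr yl where "yr t = X t - t * g (lo t)" and "yl t = X t - t * g (hi t)" for t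
  have yl_yr: "yl t < yr t" if "t \<in> {0<..<S}" for t
    using lohi[OF that] that unfolding yl_def yr_def by simp
  have yr: "yr t < x0" if t: "t \<in> {0<..<S}" for t
  proof -
    have Xt: "X t < x0 + t * g c" using T2(2)[of t] t S by auto
    have "yr t \<le> x0 + t * g c - t * g c"
      unfolding yr_def using t Xt U_lo[OF t] T1(2)[of t] S by (intro feet_mono) auto
    \<comment> \<open>Foot \<open>x0\<close> would put \<open>lo t\<close> into \<open>C x0\<close>,
      hence \<open>c \<le> lo t\<close>, and \<open>X t\<close> would not lie left of the line of
      \<open>c\<close>.\<close>
    moreover have "yr t \<noteq> x0"
    proof
      assume "yr t = x0"
      then have "lo t \<in> C x0" using t U_lo[OF t] unfolding yr_def by (intro C_I) auto
      then have "t * g c \<le> t * g (lo t)" using c(2) t by simp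
      then show False using Xt \<open>yr t = x0\<close> unfolding yr_def by simp
    qed
    ultimately show ?thesis by simp
  qed
  have yr_yl: "yr t \<le> yl s" if t: "t \<in> {0<..<S}" and s: "0 < s" "s < t" for s t
  proof -
    \<comment> \<open>\<open>D\<close> is the signed distance of the shock from the backward
      characteristic of \<open>lo t\<close>. It is positive at time 0 because
      \<open>yr t < x0\<close>, and it has no zero before \<open>t\<close> because the minimizer on
      that line is unique while the shock carries two.\<close>
    define D where "D r = X r - (yr t + r * g (lo t))" for r
    have "continuous_on {0..s} X" using X(1) that S unfolding shock_def
      by (auto elim!: continuous_on_subset)
    then have contD: "continuous_on {0..s} D" unfolding D_def by (intro continuous_intros)
    have single: "U (yr t + r * g (lo t)) r = {lo t}" if "0 < r" "r < t" for r
      using U_line_unique[of r t "lo t" "yr t"] U_lo[OF t] that unfolding yr_def by simp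
    have Dne: "D r \<noteq> 0" if r: "0 < r" "r < t" for r
    proof
      assume "D r = 0"
      then have "U (X r) r = {lo t}" using single[OF r] unfolding D_def by simp
      then show False using U_lo[of r] U_hi[of r] lohi[of r] r t by simp
    qed
    have "D s > 0"
    proof (rule ccontr)
      assume "\<not> D s > 0"
      moreover have D0: "D 0 > 0" using yr[OF t] X(1) unfolding D_def shock_def by simp
      ultimately obtain r where "0 \<le> r" "r \<le> s" "D r = 0"
        using IVT2'[of D s 0 0] contD s by auto
      then show False using Dne[of r] D0 s by (cases "r = 0") auto
    qed
    then have "yr t + s * g (lo t) - s * g (lo t) \<le> yl s"
      unfolding yl_def using s t single[OF s] U_hi[of s] by (intro feet_mono) (auto simp: D_def)
    then show ?thesis by simp
  qed
  have "\<exists>q. q \<in> \<rat> \<and> yl t < q \<and> q < yr t" if "t \<in> {0<..<S}" for t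
    using Rats_dense_in_real[OF yl_yr[OF that]] by blast
  then obtain q where q: "\<And>t. t \<in> {0<..<S} \<Longrightarrow> q t \<in> \<rat> \<and> yl t < q t \<and> q t < yr t" by metis
  have less: "q t < q s" if "s \<in> {0<..<S}" "t \<in> {0<..<S}" "s < t" for s t
    using q[OF that(1)] q[OF that(2)] yr_yl[of t s] that by auto
  have "inj_on q {0<..<S}"
    by (rule inj_onI) (metis less linorder_neqE_linordered_idom less_irrefl)
  moreover have "q ` {0<..<S} \<subseteq> \<rat>" using q by auto
  ultimately have "countable {0<..<S}"
    using countable_rat countable_subset countable_image_inj_on by metis
  then show False using S(1) uncountable_open_interval by blast
qed

section \<open>Reflection\<close>

text \<open>If \<open>u(x,t)\<close> solves the problem, then \<open>-u(-x,t)\<close> solves it for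
  the flux \<open>f(-s)\<close>, and \<open>\<Phi>(-y)\<close> is a primitive of the reflected
  data.\<close>

lemma reflect: "convex_flux (\<lambda>s. f (- s)) (\<lambda>s. - g (- s)) (\<lambda>y. \<Phi> (- y)) M"
proof
  show "((\<lambda>s. f (- s)) has_real_derivative - g (- s)) (at s)" for s
    using DERIV_chain2[OF deriv_f[of "- s"] DERIV_minus[OF DERIV_ident]] by simp
  show "strict_mono (\<lambda>s. - g (- s))" by (rule strict_monoI) simp
  show "continuous_on UNIV (\<lambda>s. - g (- s))"
    by (intro continuous_intros continuous_on_compose2[OF cont_g]) auto
  show "\<bar>\<Phi> (- x) - \<Phi> (- y)\<bar> \<le> M * \<bar>x - y\<bar>" for x y
    using lipschitz_\<Phi>[of "-x" "-y"] by (simp add: abs_minus_commute)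
qed

interpretation R: convex_flux "\<lambda>s. f (- s)" "\<lambda>s. - g (- s)" "\<lambda>y. \<Phi> (- y)" M
  by (rule reflect)

lemma reflect_F: "R.F u x t = F (- u) (- x) t"
  unfolding R.F_def F_def R.H_def H_def by (simp add: algebra_simps)

lemma reflect_U: "u \<in> R.U x t \<longleftrightarrow> - u \<in> U (- x) t"
  unfolding R.U_def U_def reflect_F by (auto, metis minus_minus)

lemma reflect_C: "c \<in> R.C x0 \<longleftrightarrow> - c \<in> C (- x0)"
  unfolding R.C_def C_def by (simp add: reflect_U)

lemma reflect_shock: "R.shock x0 T X \<longleftrightarrow> shock (- x0) T (\<lambda>t. - X t)"
proof -
  have "continuous_on {0..<T} X \<longleftrightarrow> continuous_on {0..<T} (\<lambda>t. - X t)"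
    using continuous_on_minus[of "{0..<T}" X] continuous_on_minus[of "{0..<T}" "\<lambda>t. - X t"] by auto
  moreover have "(\<exists>u\<in>R.U x t. \<exists>v\<in>R.U x t. u < v) \<longleftrightarrow> (\<exists>u\<in>U (- x) t. \<exists>v\<in>U (- x) t. u < v)" for x t
    unfolding Bex_def reflect_U by (metis minus_minus neg_less_iff_less)
  ultimately show ?thesis unfolding R.shock_def shock_def by auto
qed

lemma right_shock:
  assumes "\<And>u. u \<in> C x0 \<Longrightarrow> \<exists>c\<in>C x0. u < c"
  obtains X where "\<And>T. T > 0 \<Longrightarrow> shock x0 T X"
    "\<And>c. c \<in> C x0 \<Longrightarrow> \<forall>\<^sub>F t in at_right 0. x0 + t * g c < X t"
proof -
  have "\<exists>c\<in>R.C (- x0). c < u" if "u \<in> R.C (- x0)" for u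
    using assms[of "- u"] that unfolding Bex_def reflect_C by (auto, metis minus_minus neg_less_iff_less)
  then obtain X where X: "\<And>T. T > 0 \<Longrightarrow> R.shock (- x0) T X"
    "\<And>c. c \<in> R.C (- x0) \<Longrightarrow> \<forall>\<^sub>F t in at_right 0. X t < - x0 + t * (- g (- c))"
    using R.left_shock by blast
  show thesis
  proof
    show "shock x0 T (\<lambda>t. - X t)" if "T > 0" for T
      using X(1)[OF that] by (simp add: reflect_shock)
    show "\<forall>\<^sub>F t in at_right 0. x0 + t * g c < - X t" if "c \<in> C x0" for c
      using X(2)[of "- c"] that by (auto simp: reflect_C elim!: eventually_mono)
  qed
qed

lemma no_right_shock:
  assumes "c \<in> C x0" "\<And>u. u \<in> C x0 \<Longrightarrow> u \<le> c"
    and "shock x0 T X" "\<forall>\<^sub>F t in at_right 0. x0 + t * g c < X t"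
  shows False
proof (rule R.no_left_shock[of "- c" "- x0" T "\<lambda>t. - X t"])
  show "- c \<in> R.C (- x0)" using assms(1) by (simp add: reflect_C)
  show "- c \<le> u" if "u \<in> R.C (- x0)" for u
    using assms(2)[of "- u"] that by (simp add: reflect_C)
  show "R.shock (- x0) T (\<lambda>t. - X t)" using assms(3) by (simp add: reflect_shock)
  show "\<forall>\<^sub>F t in at_right 0. - X t < - x0 + t * - g (- (- c))"
    using assms(4) by (auto elim!: eventually_mono)
qed

lemma difference_quotient_left:
  assumes "c \<in> C x0" "e > 0"
  shows "\<forall>\<^sub>F l in at_left 0. \<Phi> (x0 + l) - \<Phi> x0 \<ge> (c + e) * l"
proof -
  have "\<forall>\<^sub>F l in at_right 0. \<Phi> (- (- x0 + l)) - \<Phi> (- (- x0)) \<ge> (- c - e) * l"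
    using assms by (intro R.difference_quotient_right) (simp_all add: reflect_C)
  then have "\<forall>\<^sub>F l in at_right 0. \<Phi> (x0 + - l) - \<Phi> x0 \<ge> (c + e) * (- l)"
    by (rule eventually_mono) (simp add: algebra_simps)
  then show ?thesis by (simp add: eventually_at_left_to_right)
qed

text \<open>Here no side of the shock is prescribed. For small times it cannot meet the line of
  \<open>c\<close>, where the minimizer is unique, so by connectedness it stays on one side; since
  \<open>c\<close> is both least and greatest, the one-sided results apply.\<close>

lemma no_shock_if_C_singleton:
  assumes C: "C x0 = {c}" and X: "shock x0 T X"
  shows False
proof -
  have cC: "c \<in> C x0" using C by simp
  obtain T1 where T1: "T1 > 0" "\<And>t. 0 < t \<Longrightarrow> t < T1 \<Longrightarrow> U (x0 + t * g c) t = {c}"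
    using C_E[OF cC] by blast
  define S where "S = min T T1"
  have S: "S > 0" "S \<le> T" "S \<le> T1" using X T1(1) unfolding S_def shock_def by auto
  define D where "D t = X t - (x0 + t * g c)" for t
  have contD: "continuous_on {0<..<S} D"
    unfolding D_def using X S unfolding shock_def
    by (intro continuous_intros) (auto elim!: continuous_on_subset)
  have ne: "D t \<noteq> 0" if t: "t \<in> {0<..<S}" for t
  proof
    assume "D t = 0"
    then have "U (X t) t = {c}" using T1(2)[of t] t S unfolding D_def by simp
    moreover have "\<exists>u\<in>U (X t) t. \<exists>v\<in>U (X t) t. u < v" using X t S unfolding shock_def by simp
    ultimately show False by simp
  qed
  have "is_interval (D ` {0<..<S})"
    using connected_continuous_image[OF contD] by (simp add: is_interval_connected_1)
  then have "(\<forall>t\<in>{0<..<S}. D t < 0) \<or> (\<forall>t\<in>{0<..<S}. D t > 0)"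
    unfolding is_interval_1 using ne by (smt (verit) imageE imageI)
  moreover have S': "\<forall>\<^sub>F t in at_right 0. t \<in> {0<..<S}"
    using S(1) by (rule eventually_at_right_real)
  ultimately consider "\<forall>\<^sub>F t in at_right 0. D t < 0" | "\<forall>\<^sub>F t in at_right 0. D t > 0"
    by (blast intro: eventually_mono)
  then show False
  proof cases
    case 1
    then show False using C by (intro no_left_shock[OF cC _ X]) (auto simp: D_def)
  next
    case 2
    then show False using C by (intro no_right_shock[OF cC _ X]) (auto simp: D_def)
  qed
qed

end

section \<open>Reduction of the maximization of \<open>E\<close>\<close>

lemma real_Limsup_bounded:
  fixes p :: "'a \<Rightarrow> real"
  assumes "N \<noteq> bot" "\<forall>\<^sub>F l in N. \<bar>p l\<bar> \<le> M"
  obtains a where "Limsup N (\<lambda>l. ereal (p l)) = ereal a" "\<bar>a\<bar> \<le> M"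
proof -
  have "Limsup N (\<lambda>l. ereal (p l)) \<le> ereal M"
    by (rule Limsup_bounded) (use assms(2) in \<open>auto elim!: eventually_mono\<close>)
  moreover have "ereal (- M) \<le> Limsup N (\<lambda>l. ereal (p l))"
    by (rule le_Limsup[OF assms(1)]) (use assms(2) in \<open>auto elim!: eventually_mono\<close>)
  ultimately show ?thesis using that by (cases "Limsup N (\<lambda>l. ereal (p l))") auto
qed

lemma real_Liminf_bounded:
  fixes p :: "'a \<Rightarrow> real"
  assumes "N \<noteq> bot" "\<forall>\<^sub>F l in N. \<bar>p l\<bar> \<le> M"
  obtains a where "Liminf N (\<lambda>l. ereal (p l)) = ereal a" "\<bar>a\<bar> \<le> M"
proof -
  have "ereal (- M) \<le> Liminf N (\<lambda>l. ereal (p l))"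
    by (rule Liminf_bounded) (use assms(2) in \<open>auto elim!: eventually_mono\<close>)
  moreover have "Liminf N (\<lambda>l. ereal (p l)) \<le> ereal M"
    by (rule order_trans[OF Liminf_le_Limsup[OF assms(1)] Limsup_bounded])
      (use assms(2) in \<open>auto elim!: eventually_mono\<close>)
  ultimately show ?thesis using that by (cases "Liminf N (\<lambda>l. ereal (p l))") auto
qed

text \<open>A passage from the oriented Lebesgue integrals of the definitions to integrals over
  closed intervals, for which the substitution rule and the fundamental theorem are used.\<close>

lemma interval_integral_lebesgue:
  fixes h :: "real \<Rightarrow> real"
  assumes "a \<le> b" "h absolutely_integrable_on {a..b}"
  shows "(LINT x=ereal a..ereal b|lebesgue. h x) = integral {a..b} h"
proof -
  have "h absolutely_integrable_on {a<..<b}"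
    by (rule set_integrable_subset[OF assms(2)]) auto
  then show ?thesis using assms(1)
    by (simp add: interval_lebesgue_integral_def set_lebesgue_integral_eq_integral
        integral_open_interval_real)
qed

lemma interval_integral_lebesgue':
  fixes h :: "real \<Rightarrow> real"
  assumes "b < a" "h absolutely_integrable_on {b..a}"
  shows "(LINT x=ereal a..ereal b|lebesgue. h x) = - integral {b..a} h"
  using interval_integral_lebesgue[of b a h] assms by (simp add: interval_lebesgue_integral_def)

lemma L_infinity_integrable:
  assumes "L_infinity \<phi>"
  obtains B where "\<And>a b. \<phi> absolutely_integrable_on {a..b}"
    "\<And>a b. a \<le> b \<Longrightarrow> \<bar>integral {a..b} \<phi>\<bar> \<le> B * (b - a)"
proof -
  obtain B0 where meas: "\<phi> \<in> borel_measurable lebesgue" and B0: "AE x in lebesgue. \<bar>\<phi> x\<bar> \<le> B0"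
    using assms unfolding L_infinity_def by blast
  define B where "B = \<bar>B0\<bar>"
  have B: "AE x in lebesgue. \<bar>\<phi> x\<bar> \<le> B" using B0 by eventually_elim (simp add: B_def)
  have ind: "integrable lebesgue (\<lambda>x. indicator {a..b} x *\<^sub>R B)" for a b :: real
    using absolutely_integrable_on_const[of "{a..b}" B] unfolding set_integrable_def by auto
  have bd: "AE x in lebesgue. norm (indicator {a..b} x *\<^sub>R \<phi> x) \<le> indicator {a..b} x *\<^sub>R B" for a b
    using B by eventually_elim (auto simp: indicator_def)
  have int: "\<phi> absolutely_integrable_on {a..b}" for a b
    unfolding set_integrable_def
  proof (rule Bochner_Integration.integrable_bound[OF ind])
    show "(\<lambda>x. indicator {a..b} x *\<^sub>R \<phi> x) \<in> borel_measurable lebesgue"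
      by (intro borel_measurable_scaleR borel_measurable_indicator meas) auto
    show "AE x in lebesgue. norm (indicator {a..b} x *\<^sub>R \<phi> x) \<le> norm (indicator {a..b} x *\<^sub>R B)"
      using bd[of a b] by eventually_elim auto
  qed
  have "\<bar>integral {a..b} \<phi>\<bar> \<le> B * (b - a)" if "a \<le> b" for a b
  proof -
    have "\<bar>integral {a..b} \<phi>\<bar> = norm (integral\<^sup>L lebesgue (\<lambda>x. indicator {a..b} x *\<^sub>R \<phi> x))"
      using set_lebesgue_integral_eq_integral(2)[OF int[of a b]] by (simp add: set_lebesgue_integral_def)
    also have "\<dots> \<le> integral\<^sup>L lebesgue (\<lambda>x. norm (indicator {a..b} x *\<^sub>R \<phi> x))"
      by (rule integral_norm_bound)
    also have "\<dots> \<le> integral\<^sup>L lebesgue (\<lambda>x. indicator {a..b} x *\<^sub>R B)"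
      using int[of a b] ind[of a b] bd[of a b] unfolding set_integrable_def
      by (intro integral_mono_AE integrable_norm) auto
    also have "\<dots> = B * (b - a)" using that by simp
    finally show ?thesis .
  qed
  then show ?thesis using that[of B] int by simp
qed

text \<open>If the nondecreasing \<open>f'\<close> took equal values at two points, it would be
  constant between them, and \<open>f''\<close> would vanish on a set of positive measure.\<close>

lemma flux_derivatives:
  assumes "flux_assms f"
  shows "(f has_real_derivative deriv f s) (at s)"
    and "(deriv f has_real_derivative deriv (deriv f) s) (at s)"
    and "strict_mono (deriv f)"
proof -
  show 1: "(f has_real_derivative deriv f s) (at s)" for s
    using assms by (simp add: flux_assms_def DERIV_deriv_iff_real_differentiable)
  show 2: "(deriv f has_real_derivative deriv (deriv f) s) (at s)" for s
    using assms by (simp add: flux_assms_def DERIV_deriv_iff_real_differentiable)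
  have nonneg: "deriv (deriv f) s \<ge> 0" for s using assms by (simp add: flux_assms_def)
  have mono: "deriv f x \<le> deriv f y" if "x \<le> y" for x y
    by (rule DERIV_nonneg_imp_nondecreasing[OF that]) (use 2 nonneg in blast)
  show "strict_mono (deriv f)"
  proof (rule strict_monoI, rule ccontr)
    fix x y :: real assume xy: "x < y" "\<not> deriv f x < deriv f y"
    have const: "deriv f z = deriv f x" if "z \<in> {x<..<y}" for z
      using mono[of x z] mono[of z y] xy that by auto
    have "deriv (deriv f) z = 0" if z: "z \<in> {x<..<y}" for z
    proof -
      have "(deriv f has_real_derivative 0) (at z)"
        by (rule has_field_derivative_transform_within_open[of "\<lambda>_. deriv f x" 0 z "{x<..<y}"])
          (use z const in auto)
      then show ?thesis using 2 DERIV_unique by blast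
    qed
    then have "{x<..<y} \<subseteq> {s. deriv (deriv f) s = 0}" by blast
    then have "{x<..<y} \<in> null_sets lebesgue"
      using assms by (auto simp: flux_assms_def intro: null_sets_subset)
    then have "emeasure lebesgue {x<..<y} = 0" by auto
    then show False using xy(1) by simp
  qed
qed

text \<open>The substitution \<open>\<xi> = x - t * deriv f s\<close> reverses orientation and turns
  the \<open>\<phi>\<close> term into a difference of \<open>\<Phi>\<close>; the remaining term
  integrates to \<open>t * H\<close>, because \<open>H' = s * f''\<close>.\<close>

lemma integral_E_integrand:
  fixes x t :: real
  assumes f: "flux_assms f" and W: "convex_flux f (deriv f) \<Phi> M"
    and int: "\<And>a b. \<phi> absolutely_integrable_on {a..b}"
    and \<Phi>: "\<And>a b. a \<le> b \<Longrightarrow> integral {a..b} \<phi> = \<Phi> b - \<Phi> a"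
    and t: "t > 0" and pq: "p \<le> q"
  defines "h \<equiv> \<lambda>s. deriv (deriv f) s * (\<phi> (x - t * deriv f s) - s)"
  shows "h absolutely_integrable_on {p..q}"
    and "t * integral {p..q} h = convex_flux.F f (deriv f) \<Phi> p x t - convex_flux.F f (deriv f) \<Phi> q x t"
proof -
  interpret convex_flux f "deriv f" \<Phi> M by (rule W)
  let ?g = "deriv f" and ?g' = "deriv (deriv f)"
  define k where "k s = x - t * ?g s" for s
  have nonneg: "?g' s \<ge> 0" for s using f by (simp add: flux_assms_def)
  have cont': "continuous_on UNIV ?g'" using f by (simp add: flux_assms_def)
  have k_less: "k r < k s \<longleftrightarrow> s < r" for r s using t by (simp add: k_def)
  have image: "k ` {p..q} = {k q..k p}"
  proof (intro equalityI subsetI)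
    fix y assume "y \<in> k ` {p..q}"
    then show "y \<in> {k q..k p}" using k_less by (fastforce simp: not_less[symmetric])
  next
    fix y assume y: "y \<in> {k q..k p}"
    then have "?g p \<le> (x - y) / t" "(x - y) / t \<le> ?g q"
      using t by (simp_all add: k_def pos_le_divide_eq pos_divide_le_eq mult.commute[of _ t])
    then obtain w where "?g w = (x - y) / t" "p \<le> w" "w \<le> q" using g_between by blast
    then show "y \<in> k ` {p..q}" using t by (intro image_eqI[of _ _ w]) (auto simp: k_def)
  qed
  \<comment> \<open>The substitution rule is an equivalence whose right-hand side is known from
    \<open>int\<close> and \<open>\<Phi>\<close>. Injectivity of \<open>k\<close> is enough for it,
    so zeros of \<open>f''\<close> do no harm.\<close>
  have "((\<lambda>s. \<bar>- t * ?g' s\<bar> * \<phi> (k s)) absolutely_integrable_on {p..q} \<and>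
      integral {p..q} (\<lambda>s. \<bar>- t * ?g' s\<bar> * \<phi> (k s)) = \<Phi> (k p) - \<Phi> (k q)) \<longleftrightarrow>
    \<phi> absolutely_integrable_on (k ` {p..q}) \<and> integral (k ` {p..q}) \<phi> = \<Phi> (k p) - \<Phi> (k q)"
  proof (rule has_absolute_integral_change_of_variables_1')
    show "(k has_field_derivative - t * ?g' s) (at s within {p..q})" for s
    proof (rule has_field_derivative_at_within)
      show "(k has_field_derivative - t * ?g' s) (at s)"
        unfolding k_def
        using DERIV_diff[OF DERIV_const DERIV_cmult[OF flux_derivatives(2)[OF f, of s], of t], of x] by simp
    qed
    show "inj_on k {p..q}" by (rule inj_onI) (metis k_less less_irrefl linorder_neqE_linordered_idom)
  qed auto
  moreover have "k q \<le> k p" using pq k_less by (simp add: not_less[symmetric])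
  moreover have "\<bar>- t * ?g' s\<bar> = t * ?g' s" for s using t nonneg by (simp add: abs_mult)
  ultimately have 1: "(\<lambda>s. t * ?g' s * \<phi> (k s)) absolutely_integrable_on {p..q}"
      "integral {p..q} (\<lambda>s. t * ?g' s * \<phi> (k s)) = \<Phi> (k p) - \<Phi> (k q)"
    using int \<Phi> unfolding image by simp_all
  have "((\<lambda>s. t * ?g' s * s) has_integral (t * H q - t * H p)) {p..q}"
  proof (rule fundamental_theorem_of_calculus[OF pq])
    fix s assume "s \<in> {p..q}"
    have "((\<lambda>s. t * H s) has_field_derivative t * ?g' s * s) (at s)"
      unfolding H_def
      using DERIV_cmult[OF DERIV_diff[OF DERIV_mult[OF DERIV_ident flux_derivatives(2)[OF f, of s]]
            flux_derivatives(1)[OF f, of s]], of t]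
      by (simp add: algebra_simps)
    then show "((\<lambda>s. t * H s) has_vector_derivative t * ?g' s * s) (at s within {p..q})"
      by (meson has_real_derivative_iff_has_vector_derivative has_vector_derivative_at_within)
  qed
  then have 2: "integral {p..q} (\<lambda>s. t * ?g' s * s) = t * H q - t * H p" by (rule integral_unique)
  have "continuous_on {p..q} (\<lambda>s. t * ?g' s * s)"
    by (intro continuous_intros continuous_on_subset[OF cont']) auto
  then have 3: "(\<lambda>s. t * ?g' s * s) absolutely_integrable_on {p..q}"
    by (rule absolutely_integrable_continuous_real)
  have eq: "t * ?g' s * \<phi> (k s) - t * ?g' s * s = t * h s" for s
    unfolding h_def k_def by (simp add: algebra_simps)
  have 4: "(\<lambda>s. t * h s) absolutely_integrable_on {p..q}"
    using set_integral_diff(1)[OF 1(1) 3] unfolding eq .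
  then show "h absolutely_integrable_on {p..q}"
    using t by (simp add: set_integrable_mult_right_iff)
  have "t * integral {p..q} h = integral {p..q} (\<lambda>s. t * h s)" by simp
  also have "\<dots> = \<Phi> (k p) - \<Phi> (k q) - (t * H q - t * H p)"
    unfolding eq[symmetric] 1(2)[symmetric] 2[symmetric]
    by (intro integral_diff set_lebesgue_integral_eq_integral(1) 1(1) 3)
  finally show "t * integral {p..q} h = F p x t - F q x t"
    unfolding F_def k_def by simp
qed

section \<open>Waves emitting from a point\<close>

text \<open>Ties the potential to the data; only differences of \<open>\<Phi>\<close> are
  prescribed, so the additive constant is free.\<close>

locale flux_problem = convex_flux f "deriv f" \<Phi> M for f \<Phi> M +
  fixes \<phi> :: "real \<Rightarrow> real"
  assumes flux: "flux_assms f"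
    and int_\<phi>: "\<phi> absolutely_integrable_on {a..b}"
    and primitive: "a \<le> b \<Longrightarrow> integral {a..b} \<phi> = \<Phi> b - \<Phi> a"

lemma flux_problem_exists:
  assumes f: "flux_assms f" and \<phi>: "L_infinity \<phi>"
  obtains \<Phi> M where "flux_problem f \<Phi> M \<phi>"
proof -
  obtain B where B: "\<And>a b. \<phi> absolutely_integrable_on {a..b}"
    "\<And>a b. a \<le> b \<Longrightarrow> \<bar>integral {a..b} \<phi>\<bar> \<le> B * (b - a)"
    by (rule L_infinity_integrable[OF \<phi>]) (rule that; blast)
  have int: "\<phi> integrable_on {a..b}" for a b
    using B(1) by (rule set_lebesgue_integral_eq_integral(1))
  \<comment> \<open>At least one of the two integrals is over an empty or one-point interval, so
    this is the oriented integral from 0 to \<open>y\<close>.\<close>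
  define \<Phi> where "\<Phi> y = integral {0..y} \<phi> - integral {y..0} \<phi>" for y
  have \<Phi>: "integral {a..b} \<phi> = \<Phi> b - \<Phi> a" if ab: "a \<le> b" for a b
  proof -
    have combine: "integral {x..y} \<phi> + integral {y..z} \<phi> = integral {x..z} \<phi>"
      if "x \<le> y" "y \<le> z" for x y z
      using that int by (rule Henstock_Kurzweil_Integration.integral_combine)
    have triv: "integral {x..y} \<phi> = 0" if "y \<le> x" for x y
      using that by (cases "x = y") auto
    consider "0 \<le> a" | "a \<le> 0" "0 \<le> b" | "b \<le> 0" by linarith
    then show ?thesis
    proof cases
      case 1
      then show ?thesis using combine[of 0 a b] ab triv[of 0 a] triv[of 0 b] by (simp add: \<Phi>_def)
    next
      case 2
      then show ?thesis using combine[of a 0 b] ab triv[of a 0] triv[of 0 b] by (simp add: \<Phi>_def)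
    next
      case 3
      then show ?thesis using combine[of a b 0] ab triv[of a 0] triv[of b 0] by (simp add: \<Phi>_def)
    qed
  qed
  have "convex_flux f (deriv f) \<Phi> B"
  proof
    show "(f has_real_derivative deriv f s) (at s)" for s by (rule flux_derivatives(1)[OF f])
    show "strict_mono (deriv f)" by (rule flux_derivatives(3)[OF f])
    show "continuous_on UNIV (deriv f)"
      using flux_derivatives(2)[OF f] by (meson DERIV_isCont continuous_at_imp_continuous_on)
    show "\<bar>\<Phi> x - \<Phi> y\<bar> \<le> B * \<bar>x - y\<bar>" for x y
      using B(2)[of x y] B(2)[of y x] \<Phi>[of x y] \<Phi>[of y x] by (cases "x \<le> y") (auto simp: abs_minus_commute)
  qed
  then have "flux_problem f \<Phi> B \<phi>"
    by (rule flux_problem.intro[OF _ flux_problem_axioms.intro[OF f B(1) \<Phi>]])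
  then show ?thesis by (rule that)
qed

context flux_problem
begin

section \<open>Translation of the defined notions\<close>

lemma LINT_\<phi>: "(LINT \<xi>=ereal x..ereal y|lebesgue. \<phi> \<xi>) = \<Phi> y - \<Phi> x"
  using interval_integral_lebesgue[OF _ int_\<phi>, of x y] interval_integral_lebesgue'[OF _ int_\<phi>, of y x]
    primitive[of x y] primitive[of y x] by (cases "x \<le> y") auto

text \<open>The base point 0 of the integral contributes a term independent of \<open>u\<close>, so
  maximizing \<open>E_fun\<close> in \<open>u\<close> means minimizing \<open>F\<close>.\<close>

lemma E_fun_eq:
  assumes "t > 0"
  shows "E_fun f \<phi> u x t = F 0 x t - F u x t"
proof -
  define h where "h s = deriv (deriv f) s * (\<phi> (x - t * deriv f s) - s)" for s
  have E: "h absolutely_integrable_on {p..q}" "t * integral {p..q} h = F p x t - F q x t"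
    if "p \<le> q" for p q
    unfolding h_def
    by (rule integral_E_integrand[OF flux convex_flux_axioms int_\<phi> _ assms that], rule primitive, assumption)+
  have def: "E_fun f \<phi> u x t = t * (LINT s=ereal 0..ereal u|lebesgue. h s)"
    by (simp add: E_fun_def h_def zero_ereal_def)
  show ?thesis
  proof (cases "0 \<le> u")
    case True
    show ?thesis
      unfolding def interval_integral_lebesgue[OF True E(1)[OF True]] by (rule E(2)[OF True])
  next
    case False
    then have u: "u < 0" "u \<le> 0" by auto
    show ?thesis
      unfolding def interval_integral_lebesgue'[OF u(1) E(1)[OF u(2)]] using E(2)[OF u(2)] by simp
  qed
qed

lemma maximizers_eq: "t > 0 \<Longrightarrow> maximizers f \<phi> x t = U x t"
  unfolding maximizers_def U_def by (auto simp: E_fun_eq)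

lemma char_values_eq: "char_values f \<phi> x0 = C x0"
  unfolding char_values_def char_line_def C_def using maximizers_eq by auto

text \<open>\<open>U x t\<close> is nonempty and bounded, so its infimum and supremum are genuine
  and differ exactly when it has two elements.\<close>

lemma traces_less_iff:
  assumes "t > 0"
  shows "right_trace f \<phi> x t < left_trace f \<phi> x t \<longleftrightarrow> (\<exists>u\<in>U x t. \<exists>v\<in>U x t. u < v)"
proof -
  have bdd: "bdd_above (U x t)" "bdd_below (U x t)"
    using U_bounded[OF assms] by (auto simp: abs_le_iff intro!: bdd_aboveI[of _ M] bdd_belowI[of _ "- M"])
      (simp add: minus_le_iff)
  have "Inf (U x t) < Sup (U x t)" if "u \<in> U x t" "v \<in> U x t" "u < v" for u v
    using cInf_lower[OF that(1) bdd(2)] cSup_upper[OF that(2) bdd(1)] that(3) by linarith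
  moreover have "\<exists>u\<in>U x t. \<exists>v\<in>U x t. u < v" if less: "Inf (U x t) < Sup (U x t)"
  proof -
    obtain v where v: "v \<in> U x t" "Inf (U x t) < v"
      using less_cSupD[OF U_nonempty[OF assms] less] by blast
    obtain u where "u \<in> U x t" "u < v"
      using cInf_lessD[OF U_nonempty[OF assms] v(2)] by blast
    then show ?thesis using v by blast
  qed
  ultimately show ?thesis
    unfolding right_trace_def left_trace_def maximizers_eq[OF assms] by blast
qed

lemma shock_from_eq: "shock_from f \<phi> x0 T X \<longleftrightarrow> shock x0 T X"
  unfolding shock_from_def shock_def by (auto simp: traces_less_iff)

text \<open>This reduces the question of a left shock to whether \<open>C x0\<close> contains a
  least element, so for a rarefaction only the membership of the endpoint matters.\<close>

lemma shock_emits_left_iff: "shock_emits_left f \<phi> x0 \<longleftrightarrow> \<not> (\<exists>c\<in>C x0. \<forall>u\<in>C x0. c \<le> u)"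
proof
  assume "shock_emits_left f \<phi> x0"
  then obtain T X where X: "shock x0 T X"
    "\<And>c. c \<in> C x0 \<Longrightarrow> \<forall>\<^sub>F t in at_right 0. X t < x0 + t * deriv f c"
    unfolding shock_emits_left_def char_values_eq shock_from_eq by auto
  show "\<not> (\<exists>c\<in>C x0. \<forall>u\<in>C x0. c \<le> u)"
  proof
    assume "\<exists>c\<in>C x0. \<forall>u\<in>C x0. c \<le> u"
    then obtain c where c: "c \<in> C x0" "\<And>u. u \<in> C x0 \<Longrightarrow> c \<le> u" by auto
    show False by (rule no_left_shock[OF c X(1) X(2)[OF c(1)]])
  qed
next
  assume "\<not> (\<exists>c\<in>C x0. \<forall>u\<in>C x0. c \<le> u)"
  then have strict: "\<exists>c\<in>C x0. c < u" if "u \<in> C x0" for u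
    using that by (auto simp: not_le)
  show "shock_emits_left f \<phi> x0"
  proof (rule left_shock[OF strict])
    fix X assume X: "\<And>T. T > 0 \<Longrightarrow> shock x0 T X"
      "\<And>c. c \<in> C x0 \<Longrightarrow> \<forall>\<^sub>F t in at_right 0. X t < x0 + t * deriv f c"
    have "shock x0 1 X" by (rule X(1)) simp
    then show ?thesis
      unfolding shock_emits_left_def char_values_eq shock_from_eq using X(2) by blast
  qed
qed

lemma shock_emits_right_iff: "shock_emits_right f \<phi> x0 \<longleftrightarrow> \<not> (\<exists>c\<in>C x0. \<forall>u\<in>C x0. u \<le> c)"
proof
  assume "shock_emits_right f \<phi> x0"
  then obtain T X where X: "shock x0 T X"
    "\<And>c. c \<in> C x0 \<Longrightarrow> \<forall>\<^sub>F t in at_right 0. x0 + t * deriv f c < X t"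
    unfolding shock_emits_right_def char_values_eq shock_from_eq by auto
  show "\<not> (\<exists>c\<in>C x0. \<forall>u\<in>C x0. u \<le> c)"
  proof
    assume "\<exists>c\<in>C x0. \<forall>u\<in>C x0. u \<le> c"
    then obtain c where c: "c \<in> C x0" "\<And>u. u \<in> C x0 \<Longrightarrow> u \<le> c" by auto
    show False by (rule no_right_shock[OF c X(1) X(2)[OF c(1)]])
  qed
next
  assume "\<not> (\<exists>c\<in>C x0. \<forall>u\<in>C x0. u \<le> c)"
  then have strict: "\<exists>c\<in>C x0. u < c" if "u \<in> C x0" for u
    using that by (auto simp: not_le)
  show "shock_emits_right f \<phi> x0"
  proof (rule right_shock[OF strict])
    fix X assume X: "\<And>T. T > 0 \<Longrightarrow> shock x0 T X"
      "\<And>c. c \<in> C x0 \<Longrightarrow> \<forall>\<^sub>F t in at_right 0. x0 + t * deriv f c < X t"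
    have "shock x0 1 X" by (rule X(1)) simp
    then show ?thesis
      unfolding shock_emits_right_def char_values_eq shock_from_eq using X(2) by blast
  qed
qed

section \<open>Dini derivatives as endpoints of the set of emitted values\<close>

definition slope :: "real \<Rightarrow> real \<Rightarrow> real" where
  "slope x0 l = (\<Phi> (x0 + l) - \<Phi> x0) / l"

lemma slope_bounded: "\<bar>slope x0 l\<bar> \<le> M"
  using lipschitz_\<Phi>[of "x0 + l" x0] M_nonneg
  by (cases "l = 0") (auto simp: slope_def pos_divide_le_eq)

lemma upper_left_Dini:
  shows "ereal (upper_left_Dini \<phi> x0) = Limsup (at_left 0) (\<lambda>l. ereal (slope x0 l))"
    and "\<bar>upper_left_Dini \<phi> x0\<bar> \<le> M"
proof -
  obtain a where a: "Limsup (at_left 0) (\<lambda>l. ereal (slope x0 l)) = ereal a" "\<bar>a\<bar> \<le> M"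
    using real_Limsup_bounded[of "at_left 0" "slope x0" M] slope_bounded by auto
  then have "upper_left_Dini \<phi> x0 = a"
    unfolding upper_left_Dini_def LINT_\<phi> by (simp add: slope_def)
  then show "ereal (upper_left_Dini \<phi> x0) = Limsup (at_left 0) (\<lambda>l. ereal (slope x0 l))"
    "\<bar>upper_left_Dini \<phi> x0\<bar> \<le> M" using a by simp_all
qed

lemma lower_right_Dini:
  shows "ereal (lower_right_Dini \<phi> x0) = Liminf (at_right 0) (\<lambda>l. ereal (slope x0 l))"
    and "\<bar>lower_right_Dini \<phi> x0\<bar> \<le> M"
proof -
  obtain b where b: "Liminf (at_right 0) (\<lambda>l. ereal (slope x0 l)) = ereal b" "\<bar>b\<bar> \<le> M"
    using real_Liminf_bounded[of "at_right 0" "slope x0" M] slope_bounded by auto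
  then have "lower_right_Dini \<phi> x0 = b"
    unfolding lower_right_Dini_def LINT_\<phi> by (simp add: slope_def)
  then show "ereal (lower_right_Dini \<phi> x0) = Liminf (at_right 0) (\<lambda>l. ereal (slope x0 l))"
    "\<bar>lower_right_Dini \<phi> x0\<bar> \<le> M" using b by simp_all
qed

text \<open>Divide the one-sided increment estimates by \<open>l\<close>, which reverses the
  inequality on the left where \<open>l < 0\<close>; then let \<open>e\<close> tend to 0.\<close>

lemma C_subset: "C x0 \<subseteq> {upper_left_Dini \<phi> x0..lower_right_Dini \<phi> x0}"
proof
  fix c assume c: "c \<in> C x0"
  have "upper_left_Dini \<phi> x0 \<le> c + e" if "e > 0" for e
  proof -
    have "\<forall>\<^sub>F l in at_left 0. l \<in> {-1<..<(0::real)}" by (rule eventually_at_left_real) simp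
    with difference_quotient_left[OF c that]
    have "\<forall>\<^sub>F l in at_left 0. ereal (slope x0 l) \<le> ereal (c + e)"
      by eventually_elim (simp add: slope_def neg_divide_le_eq)
    then have "Limsup (at_left 0) (\<lambda>l. ereal (slope x0 l)) \<le> ereal (c + e)" by (rule Limsup_bounded)
    then show ?thesis unfolding upper_left_Dini(1)[symmetric] by simp
  qed
  then have "upper_left_Dini \<phi> x0 \<le> c" by (rule field_le_epsilon)
  moreover have "c \<le> lower_right_Dini \<phi> x0 + e" if "e > 0" for e
  proof -
    have "\<forall>\<^sub>F l in at_right 0. l \<in> {0<..<(1::real)}" by (rule eventually_at_right_real) simp
    with difference_quotient_right[OF c that]
    have "\<forall>\<^sub>F l in at_right 0. ereal (c - e) \<le> ereal (slope x0 l)"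
      by eventually_elim (simp add: slope_def pos_le_divide_eq)
    then have "ereal (c - e) \<le> Liminf (at_right 0) (\<lambda>l. ereal (slope x0 l))" by (rule Liminf_bounded)
    then show ?thesis unfolding lower_right_Dini(1)[symmetric] by simp
  qed
  then have "c \<le> lower_right_Dini \<phi> x0" by (rule field_le_epsilon)
  ultimately show "c \<in> {upper_left_Dini \<phi> x0..lower_right_Dini \<phi> x0}" by simp
qed

text \<open>Strictly between the Dini derivatives the linear lower bound on \<open>\<Phi>\<close>
  holds near \<open>x0\<close> on both sides. At an endpoint the limits alone do not decide it,
  which is the source of the four rarefaction cases.\<close>

lemma subset_C: "{upper_left_Dini \<phi> x0<..<lower_right_Dini \<phi> x0} \<subseteq> C x0"
proof
  fix c assume c: "c \<in> {upper_left_Dini \<phi> x0<..<lower_right_Dini \<phi> x0}"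
  show "c \<in> C x0"
  proof (rule mem_C_I)
    show "\<bar>c\<bar> \<le> M" using c upper_left_Dini(2)[of x0] lower_right_Dini(2)[of x0] by auto
    have "ereal c < Liminf (at_right 0) (\<lambda>l. ereal (slope x0 l))"
      unfolding lower_right_Dini(1)[symmetric] using c by simp
    then have "\<forall>\<^sub>F l in at_right 0. ereal c < ereal (slope x0 l)" by (rule less_LiminfD)
    moreover have "\<forall>\<^sub>F l in at_right 0. l \<in> {0<..<(1::real)}" by (rule eventually_at_right_real) simp
    ultimately have right: "\<forall>\<^sub>F l in at_right 0. c * l \<le> \<Phi> (x0 + l) - \<Phi> x0"
      by eventually_elim (simp add: slope_def pos_less_divide_eq)
    have "Limsup (at_left 0) (\<lambda>l. ereal (slope x0 l)) < ereal c"
      unfolding upper_left_Dini(1)[symmetric] using c by simp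
    then have "\<forall>\<^sub>F l in at_left 0. ereal (slope x0 l) < ereal c" by (rule Limsup_lessD)
    moreover have "\<forall>\<^sub>F l in at_left 0. l \<in> {-1<..<(0::real)}" by (rule eventually_at_left_real) simp
    ultimately have "\<forall>\<^sub>F l in at_left 0. c * l \<le> \<Phi> (x0 + l) - \<Phi> x0"
      by eventually_elim (simp add: slope_def neg_divide_less_eq)
    with right show "\<forall>\<^sub>F l in at 0. c * l \<le> \<Phi> (x0 + l) - \<Phi> x0"
      by (simp add: eventually_at_split)
  qed
qed

end

section \<open>The six cases\<close>

lemma interval_between:
  fixes a b :: real
  assumes "C \<subseteq> {a..b}" "{a<..<b} \<subseteq> C" "a < b"
  shows "C = {a..b} \<or> C = {a<..b} \<or> C = {a..<b} \<or> C = {a<..<b}"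
proof -
  have Icc: "a \<le> x \<and> x \<le> b" if "x \<in> C" for x using subsetD[OF assms(1) that] by simp
  have Ioo: "x \<in> C" if "a < x" "x < b" for x using subsetD[OF assms(2), of x] that by simp
  have "C = {a..b}" if "a \<in> C" "b \<in> C"
    by (rule set_eqI, unfold atLeastAtMost_iff) (metis Icc Ioo that order_le_less)
  moreover have "C = {a..<b}" if "a \<in> C" "b \<notin> C"
    by (rule set_eqI, unfold atLeastLessThan_iff) (metis Icc Ioo that order_le_less)
  moreover have "C = {a<..b}" if "a \<notin> C" "b \<in> C"
    by (rule set_eqI, unfold greaterThanAtMost_iff) (metis Icc Ioo that order_le_less)
  moreover have "C = {a<..<b}" if "a \<notin> C" "b \<notin> C"
    by (rule set_eqI, unfold greaterThanLessThan_iff) (metis Icc Ioo that order_le_less)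
  ultimately show ?thesis by argo
qed
theorem theorem3p9:
  fixes f \<phi> :: "real \<Rightarrow> real" and x0 a b :: real and C :: "real set"
  assumes "flux_assms f" and "L_infinity \<phi>"
  defines "a \<equiv> upper_left_Dini \<phi> x0" and "b \<equiv> lower_right_Dini \<phi> x0"
    and "C \<equiv> char_values f \<phi> x0"
  shows "((a > b \<or> a = b \<and> C = {}) \<or> (a = b \<and> C \<noteq> {}) \<or>
          (a < b \<and> C = {a..b}) \<or> (a < b \<and> C = {a<..b}) \<or>
          (a < b \<and> C = {a..<b}) \<or> (a < b \<and> C = {a<..<b})) \<and>
         (a > b \<or> a = b \<and> C = {} \<longrightarrow> wave_S f \<phi> x0) \<and>
         (a = b \<and> C \<noteq> {} \<longrightarrow> wave_characteristic f \<phi> x0) \<and>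
         (a < b \<and> C = {a..b} \<longrightarrow> wave_R f \<phi> x0) \<and>
         (a < b \<and> C = {a<..b} \<longrightarrow> wave_SR f \<phi> x0) \<and>
         (a < b \<and> C = {a..<b} \<longrightarrow> wave_RS f \<phi> x0) \<and>
         (a < b \<and> C = {a<..<b} \<longrightarrow> wave_SRS f \<phi> x0)"
proof -
  have C_eq: "C = char_values f \<phi> x0" by (simp only: C_def)
  obtain \<Phi> M where "flux_problem f \<Phi> M \<phi>" by (rule flux_problem_exists[OF assms(1,2)])
  then interpret flux_problem f \<Phi> M \<phi> .
  have C: "C = convex_flux.C f (deriv f) \<Phi> x0" unfolding C_eq by (rule char_values_eq)
  have sub: "C \<subseteq> {a..b}" "{a<..<b} \<subseteq> C"
    unfolding C a_def b_def by (rule C_subset, rule subset_C)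
  have emits_left: "shock_emits_left f \<phi> x0 \<longleftrightarrow> \<not> (\<exists>c\<in>C. \<forall>u\<in>C. c \<le> u)"
    and emits_right: "shock_emits_right f \<phi> x0 \<longleftrightarrow> \<not> (\<exists>c\<in>C. \<forall>u\<in>C. u \<le> c)"
    unfolding C by (rule shock_emits_left_iff, rule shock_emits_right_iff)
  have cases: "C = {a..b} \<or> C = {a<..b} \<or> C = {a..<b} \<or> C = {a<..<b}" if "a < b"
    by (rule interval_between[OF sub that])
  have S: "wave_S f \<phi> x0" if "a > b \<or> a = b \<and> C = {}"
  proof -
    \<comment> \<open>For \<open>a > b\<close> the enclosing interval \<open>{a..b}\<close> is
      empty.\<close>
    have "C = {}" using that sub(1) by auto
    then have "shock_emits_left f \<phi> x0" by (simp add: emits_left)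
    then show ?thesis using \<open>C = {}\<close> unfolding wave_S_def characteristics_def C_eq
        shock_emits_left_def shock_emits_def by auto
  qed
  have characteristic: "wave_characteristic f \<phi> x0" if "a = b" "C \<noteq> {}"
  proof -
    have Ca: "C = {a}" using that sub(1) by auto
    then have "\<not> shock_emits f \<phi> x0"
      unfolding shock_emits_def shock_from_eq using no_shock_if_C_singleton[of x0 a] C by auto
    then show ?thesis using Ca unfolding wave_characteristic_def characteristics_def C_eq by auto
  qed
  have least: "\<not> (\<exists>c\<in>C. \<forall>u\<in>C. c \<le> u)" if "a < b" "C = {a<..b} \<or> C = {a<..<b}"
  proof
    assume "\<exists>c\<in>C. \<forall>u\<in>C. c \<le> u"
    then obtain c where c: "c \<in> C" "\<forall>u\<in>C. c \<le> u" by blast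
    then have "a < c" "c \<le> b" using that by auto
    \<comment> \<open>The midpoint of \<open>c\<close> and the excluded endpoint is a smaller
      element, so no least one exists.\<close>
    then have "(a + c) / 2 \<in> C" using that by auto
    with c have "c \<le> (a + c) / 2" by blast
    with \<open>a < c\<close> show False by simp
  qed
  have greatest: "\<not> (\<exists>c\<in>C. \<forall>u\<in>C. u \<le> c)" if "a < b" "C = {a..<b} \<or> C = {a<..<b}"
  proof
    assume "\<exists>c\<in>C. \<forall>u\<in>C. u \<le> c"
    then obtain c where c: "c \<in> C" "\<forall>u\<in>C. u \<le> c" by blast
    then have "c < b" "a \<le> c" using that by auto
    then have "(b + c) / 2 \<in> C" using that by auto
    with c have "(b + c) / 2 \<le> c" by blast
    with \<open>c < b\<close> show False by simp
  qed
  have rarefaction: "rarefaction_emits f \<phi> x0" if "a < b"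
  proof -
    have "is_interval C" using cases[OF that] by (auto simp: is_interval_cc is_interval_io
        is_interval_oc is_interval_co is_interval_oo)
    moreover have "(2 * a + b) / 3 \<in> C" "(a + 2 * b) / 3 \<in> C" using sub(2) that by auto
    moreover have "(2 * a + b) / 3 < (a + 2 * b) / 3" using that by simp
    ultimately show ?thesis unfolding rarefaction_emits_def C_eq by blast
  qed
  have "wave_R f \<phi> x0" if "a < b" "C = {a..b}"
    using rarefaction that unfolding wave_R_def emits_left emits_right by auto
  moreover have "wave_SR f \<phi> x0" if "a < b" "C = {a<..b}"
    using rarefaction least that unfolding wave_SR_def emits_left emits_right by auto
  moreover have "wave_RS f \<phi> x0" if "a < b" "C = {a..<b}"
    using rarefaction greatest that unfolding wave_RS_def emits_left emits_right by auto
  moreover have "wave_SRS f \<phi> x0" if "a < b" "C = {a<..<b}"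
    using rarefaction least greatest that unfolding wave_SRS_def emits_left emits_right by auto
  moreover have "(a > b \<or> a = b \<and> C = {}) \<or> (a = b \<and> C \<noteq> {}) \<or>
          (a < b \<and> C = {a..b}) \<or> (a < b \<and> C = {a<..b}) \<or>
          (a < b \<and> C = {a..<b}) \<or> (a < b \<and> C = {a<..<b})"
    using cases linorder_less_linear[of a b] by argo
  ultimately show ?thesis using S characteristic by blast
qed

end
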